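(* Let $\lambda>0$, $r>0$, $\vartheta>0$, and let $L$ be a non-negative random variable with Laplace transform $\ell(\gamma)=\mathbb{E}\,e^{-\gamma L}$. For $n\in\{0,1,2,\ldots\}$ let $\psi_n(\gamma)$ be the double transform of the ruin probability in the transient Cramér–Lundberg model with $n$ initial obligors (defined in the context). Then $\psi_0(\gamma)= 0$ for all $\gamma>0$, and for every $n\in\mathbb{N}=\{1,2,\ldots\}$ and every $\gamma>0$ with $\gamma\neq \frac{\lambda n+\vartheta}{rn}$, \[\psi_{n}(\gamma)= \frac{\lambda n}{\lambda n+\vartheta}\,\frac{1}{\gamma}+\frac{\lambda n}{\lambda n +\vartheta-\gamma r n}\left(B\left(\frac{\lambda n +\vartheta}{r n},\,\psi_{n-1}\left(\frac{\lambda n +\vartheta}{rn}\right)\right)-B\left(\gamma,\psi_{n-1}(\gamma)\right)\right),\] where \[B(x,y):= \ell(x)\left(\frac{1}{x}-y\right).\]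
   Context: Model. At time $0$ there are $n$ obligors and the initial reserve is $u>0$. The times-to-default $T_1,\ldots,T_n$ are i.i.d. exponential with rate $\lambda$ (mean $\lambda^{-1}$). When an obligor defaults, the company incurs a loss distributed as $L$ and the obligor leaves the system; the losses $L_1,\ldots,L_n$ are i.i.d. copies of $L$, independent of the default times. While exactly $i$ obligors have not yet defaulted, the reserve increases linearly at rate $ri$, $i\in\{0,\ldots,n\}$. The net cumulative loss process (losses minus income) is thus \[Z_n(s)=\sum_{i=1}^n\left(1_{\{T_i\leqslant s\}}L_i-r\min\{T_i,s\}\right),\qquad s\geqslant 0,\] and the reserve at time $s$ is $u-Z_n(s)$. Ruin probability. $p_n(u,t):=\mathbb{P}(\exists s\in[0,t]: Z_n(s)\geqslant u)$ is the probability of ruin before time $t$ with $n$ initial obligors and initial reserve $u$. Also $p_n(u):=\int_0^\infty \vartheta e^{-\vartheta t}p_n(u,t)\,\mathrm{d}t$, the probability of ruin before an independent exponentially distributed time with mean $\vartheta^{-1}$. Double transform. For $\gamma>0$, \[\psi_n(\gamma):=\int_0^\infty e^{-\gamma u}\int_0^\infty\vartheta e^{-\vartheta t}p_n(u,t)\,\mathrm{d}t\,\mathrm{d}u=\int_0^\infty e^{-\gamma u}p_n(u)\,\mathrm{d}u .\] *)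

theory Defs
  imports "HOL-Probability.Probability"
begin

text \<open>
  A pool of \<open>n\<close> obligors, indexed by \<open>{1..n}\<close>, on the probability space \<open>M\<close>. Only the values of
  \<open>T\<close> and \<open>Ls\<close> at indices in \<open>{1..n}\<close> are constrained. The last assumption says that the vector of
  default times is independent of the vector of losses.
\<close>

locale obligor_pool = prob_space M for M :: "'a measure" +
  fixes n :: nat and T Ls :: "nat \<Rightarrow> 'a \<Rightarrow> real" and lam :: real and Q :: "real measure"
  assumes default_time_distributed:
      "\<And>i. i \<in> {1..n} \<Longrightarrow> distributed M lborel (T i) (exponential_density lam)"
    and default_times_indep: "indep_vars (\<lambda>_. borel) T {1..n}"
    and loss_distr: "\<And>i. i \<in> {1..n} \<Longrightarrow> distr M borel (Ls i) = Q"
    and losses_indep: "indep_vars (\<lambda>_. borel) Ls {1..n}"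
    and default_times_losses_indep:
      "indep_var (Pi\<^sub>M {1..n} (\<lambda>_. borel)) (\<lambda>\<omega>. \<lambda>i\<in>{1..n}. T i \<omega>)
                 (Pi\<^sub>M {1..n} (\<lambda>_. borel)) (\<lambda>\<omega>. \<lambda>i\<in>{1..n}. Ls i \<omega>)"

definition net_loss ::
  "real \<Rightarrow> nat \<Rightarrow> (nat \<Rightarrow> 'a \<Rightarrow> real) \<Rightarrow> (nat \<Rightarrow> 'a \<Rightarrow> real) \<Rightarrow> real \<Rightarrow> 'a \<Rightarrow> real" where
  "net_loss r n T Ls s \<omega> =
     (\<Sum>i=1..n. (if T i \<omega> \<le> s then Ls i \<omega> else 0) - r * min (T i \<omega>) s)"

text \<open>
  For \<open>r \<ge> 0\<close> the net loss is non-increasing between default times, so the ruin event only depends on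
  \<open>s = 0\<close> and the finitely many default times in \<open>[0, t]\<close>. Hence it is measurable, although the
  quantifier over \<open>s\<close> is uncountable.
\<close>

definition ruin_prob ::
  "real \<Rightarrow> 'a measure \<Rightarrow> nat \<Rightarrow> (nat \<Rightarrow> 'a \<Rightarrow> real) \<Rightarrow> (nat \<Rightarrow> 'a \<Rightarrow> real) \<Rightarrow> real \<Rightarrow> real \<Rightarrow> real" where
  "ruin_prob r M n T Ls u t =
     measure M {\<omega> \<in> space M. \<exists>s\<in>{0..t}. net_loss r n T Ls s \<omega> \<ge> u}"

definition ruin_prob_killed ::
  "real \<Rightarrow> real \<Rightarrow> 'a measure \<Rightarrow> nat \<Rightarrow> (nat \<Rightarrow> 'a \<Rightarrow> real) \<Rightarrow> (nat \<Rightarrow> 'a \<Rightarrow> real) \<Rightarrow> real \<Rightarrow> real" where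
  "ruin_prob_killed r \<theta> M n T Ls u =
     (LINT t:{0..}|lborel. \<theta> * exp (- \<theta> * t) * ruin_prob r M n T Ls u t)"

definition ruin_transform ::
  "real \<Rightarrow> real \<Rightarrow> 'a measure \<Rightarrow> nat \<Rightarrow> (nat \<Rightarrow> 'a \<Rightarrow> real) \<Rightarrow> (nat \<Rightarrow> 'a \<Rightarrow> real) \<Rightarrow> real \<Rightarrow> real" where
  "ruin_transform r \<theta> M n T Ls \<gamma> =
     (LINT u:{0..}|lborel. exp (- \<gamma> * u) * ruin_prob_killed r \<theta> M n T Ls u)"

definition laplace_transform :: "'b measure \<Rightarrow> ('b \<Rightarrow> real) \<Rightarrow> real \<Rightarrow> real" where
  "laplace_transform N X \<gamma> = (LINT \<omega>|N. exp (- \<gamma> * X \<omega>))"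

end

theory Submission
  imports Defs
begin

text \<open>
  For positive \<open>u\<close>, ruin can only happen at a default. Before the first default, at time \<open>x\<close>, the
  reserve has grown from \<open>u\<close> to \<open>u + r n x\<close>; the default costs a loss \<open>y\<close>; and by the lack of memory of the
  exponential law the remaining \<open>n - 1\<close> obligors then form a fresh pool, with initial reserve
  \<open>u + r n x - y\<close> and horizon \<open>t - x\<close>. The first default time is exponential with rate \<open>\<lambda> n\<close>, so
  \<open>p_n(u, t) = \<lambda> n \<integral> exp (- \<lambda> n x) E[p_{n-1}(u + r n x - L, t - x)] dx\<close>
  (integral over \<open>x \<ge> 0\<close>), where \<open>p_k(v, s)\<close> is \<open>1\<close> for \<open>v \<le> 0 \<le> s\<close> (ruin has already happened) and \<open>0\<close> for \<open>s < 0\<close>. This is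
  \<open>pool_ruin_recursion\<close>.

  Killing at an exponential time with rate \<open>\<theta>\<close> turns the horizon shift \<open>t - x\<close> into the factor
  \<open>exp (- \<theta> x)\<close>. With \<open>a = \<lambda> n + \<theta>\<close> and \<open>h(v) = E[p_{n-1}(v - L)]\<close> this gives
  \<open>p_n(u) = \<lambda> n \<integral> exp (- a x) h(u + r n x) dx\<close> (\<open>killed_ruin_recursion\<close>).
  The Laplace transform in \<open>u\<close> is computed by the substitution \<open>v = u + r n x\<close>: the weight that multiplies
  \<open>h(v)\<close> is an integral over \<open>0 \<le> x \<le> v / (r n)\<close> of exponentials, equal to
  \<open>(exp (- \<gamma> v) - exp (- \<alpha> v)) / (a - \<gamma> r n)\<close> with \<open>\<alpha> = a / (r n)\<close> (\<open>nn_laplace_ramp\<close>). So \<open>\<psi>_n(\<gamma>)\<close> is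
  \<open>\<lambda> n / (a - \<gamma> r n)\<close> times the difference of the transforms of \<open>h\<close> at \<open>\<gamma>\<close> and at \<open>\<alpha>\<close>, which
  explains the second evaluation point in the formula. Finally the transform of \<open>h\<close> at \<open>\<gamma>\<close> is
  \<open>1 / \<gamma> - B(\<gamma>, \<psi>_{n-1}(\<gamma>))\<close>, because a loss \<open>y\<close> ruins every reserve below \<open>y\<close> and shifts the others
  (\<open>laplace_claim_ruin\<close>).

  The pools for different \<open>n\<close> live on unrelated probability spaces, so the recursion is proved for the
  product measure of default times and losses, indexed by an arbitrary finite set of obligors.
  Summing over the obligor that defaults first removes one index from that set, and the resulting
  recursion itself shows that only the number of obligors matters; no permutation of coordinates is
  ever applied. All of this is done with nonnegative integrals, where Fubini and substitution only ask for
  measurability; real-valued integrals return where two transforms are subtracted.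
\<close>

section \<open>Ruin along a fixed path\<close>

definition pool_loss :: "real \<Rightarrow> 'i set \<Rightarrow> ('i \<Rightarrow> real) \<Rightarrow> ('i \<Rightarrow> real) \<Rightarrow> real \<Rightarrow> real" where
  "pool_loss r I \<tau> l s = (\<Sum>i\<in>I. (if \<tau> i \<le> s then l i else 0) - r * min (\<tau> i) s)"

definition ruined :: "real \<Rightarrow> 'i set \<Rightarrow> ('i \<Rightarrow> real) \<Rightarrow> ('i \<Rightarrow> real) \<Rightarrow> real \<Rightarrow> real \<Rightarrow> bool" where
  "ruined r I \<tau> l u t \<longleftrightarrow> (\<exists>s\<in>{0..t}. u \<le> pool_loss r I \<tau> l s)"

lemma ruined_negative_horizon: "t < 0 \<Longrightarrow> \<not> ruined r I \<tau> l u t"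
  by (auto simp: ruined_def)

lemma ruined_empty: "ruined r {} \<tau> l u t \<longleftrightarrow> 0 \<le> t \<and> u \<le> 0"
  by (auto simp: ruined_def pool_loss_def intro!: bexI[of _ 0])

lemma ruined_at_time_0:
  assumes "\<And>i. i \<in> I \<Longrightarrow> 0 < \<tau> i" "u \<le> 0" "0 \<le> t"
  shows "ruined r I \<tau> l u t"
proof -
  have "pool_loss r I \<tau> l 0 = 0"
    unfolding pool_loss_def by (rule sum.neutral) (use assms(1) in force)
  with assms show ?thesis by (auto simp: ruined_def intro!: bexI[of _ 0])
qed

text \<open>
  Between defaults the net loss cannot increase, so each level that is reached is already reached at the last
  default before that moment, or at time \<open>0\<close>. This replaces the uncountable quantifier over
  time by a finite disjunction, which is what makes ruin a measurable event (\<open>pred_ruined\<close>). Negative default times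
  have probability \<open>0\<close> but are points of the product space, hence the condition \<open>0 \<le> \<tau> i\<close>.
\<close>

lemma ruined_iff_at_default:
  assumes "finite I" "0 \<le> r"
  shows "ruined r I \<tau> l u t \<longleftrightarrow>
    0 \<le> t \<and> (u \<le> pool_loss r I \<tau> l 0 \<or> (\<exists>i\<in>I. 0 \<le> \<tau> i \<and> \<tau> i \<le> t \<and> u \<le> pool_loss r I \<tau> l (\<tau> i)))"
proof
  assume "ruined r I \<tau> l u t"
  then obtain s where s: "0 \<le> s" "s \<le> t" "u \<le> pool_loss r I \<tau> l s" by (auto simp: ruined_def)
  \<comment> \<open>The last default up to \<open>s\<close> is the maximum of a finite set; the element \<open>0\<close> makes it nonempty.\<close>
  define A where "A = insert 0 (\<tau> ` {i\<in>I. 0 \<le> \<tau> i \<and> \<tau> i \<le> s})"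
  define s' where "s' = Max A"
  have A: "finite A" "A \<noteq> {}" using assms by (auto simp: A_def)
  have s'A: "s' \<in> A" unfolding s'_def using A by (rule Max_in)
  have s's: "s' \<le> s" using s'A s(1) by (auto simp: A_def)
  have s'0: "0 \<le> s'" unfolding s'_def using A by (auto simp: A_def)
  have le: "\<tau> i \<le> s'" if "i \<in> I" "\<tau> i \<le> s" for i
  proof (cases "0 \<le> \<tau> i")
    case True
    then have "\<tau> i \<in> A" using that by (auto simp: A_def)
    then show ?thesis unfolding s'_def using A by simp
  qed (use s'0 in simp)
  have "pool_loss r I \<tau> l s \<le> pool_loss r I \<tau> l s'"
    unfolding pool_loss_def
  proof (rule sum_mono)
    fix i assume i: "i \<in> I"
    have "r * min (\<tau> i) s' \<le> r * min (\<tau> i) s"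
      using s's assms by (intro mult_left_mono) auto
    with le[OF i] s's show "(if \<tau> i \<le> s then l i else 0) - r * min (\<tau> i) s
        \<le> (if \<tau> i \<le> s' then l i else 0) - r * min (\<tau> i) s'" by auto
  qed
  with s have "u \<le> pool_loss r I \<tau> l s'" by simp
  with s'A s s's show "0 \<le> t \<and> (u \<le> pool_loss r I \<tau> l 0 \<or>
      (\<exists>i\<in>I. 0 \<le> \<tau> i \<and> \<tau> i \<le> t \<and> u \<le> pool_loss r I \<tau> l (\<tau> i)))"
    by (force simp: A_def)
qed (auto simp: ruined_def)

lemma pred_ruined:
  assumes [simp]: "finite I" and "0 \<le> r"
    and [measurable]: "\<And>i. i \<in> I \<Longrightarrow> (\<lambda>z. \<tau> z i) \<in> borel_measurable S"
      "\<And>i. i \<in> I \<Longrightarrow> (\<lambda>z. l z i) \<in> borel_measurable S"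
      "u \<in> borel_measurable S" "t \<in> borel_measurable S"
  shows "Measurable.pred S (\<lambda>z. ruined r I (\<tau> z) (l z) (u z) (t z))"
proof -
  have [measurable]: "(\<lambda>z. pool_loss r I (\<tau> z) (l z) (s z)) \<in> borel_measurable S"
    if [measurable]: "s \<in> borel_measurable S" for s
    unfolding pool_loss_def by measurable
  show ?thesis
    unfolding ruined_iff_at_default[OF assms(1,2)] by measurable
qed

text \<open>
  The pathwise form of the recursion: \<open>i\<close> is the first to default, at time \<open>x\<close> with loss \<open>y\<close>.
  Up to \<open>x\<close> all \<open>card (insert i J)\<close> obligors pay, so the net loss stays nonpositive and cannot reach \<open>u\<close>;
  after \<open>x\<close> it is that of the remaining pool with the clock restarted, plus a constant.
\<close>

lemma ruined_first_default:
  assumes I: "finite J" "i \<notin> J" and x: "0 \<le> x" and u: "0 < u" and r: "0 \<le> r"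
    and \<tau>: "\<And>j. j \<in> J \<Longrightarrow> 0 < \<tau> j"
    and \<tau>': "\<tau>' i = x" "\<And>j. j \<in> J \<Longrightarrow> \<tau>' j = \<tau> j + x"
    and l': "l' i = y" "\<And>j. j \<in> J \<Longrightarrow> l' j = l j"
  shows "ruined r (insert i J) \<tau>' l' u t \<longleftrightarrow>
    ruined r J \<tau> l (u + r * real (card (insert i J)) * x - y) (t - x)"
proof -
  have before: "pool_loss r (insert i J) \<tau>' l' s \<le> 0" if s: "0 \<le> s" "s < x" for s
  proof -
    have "pool_loss r (insert i J) \<tau>' l' s = (\<Sum>j\<in>insert i J. - (r * s))"
      unfolding pool_loss_def
    proof (rule sum.cong)
      fix j assume "j \<in> insert i J"
      then have "s < \<tau>' j" using \<tau> \<tau>' s by force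
      then show "(if \<tau>' j \<le> s then l' j else 0) - r * min (\<tau>' j) s = - (r * s)" by simp
    qed simp
    also have "\<dots> \<le> 0" using r s by (intro sum_nonpos) auto
    finally show ?thesis .
  qed
  have after: "pool_loss r (insert i J) \<tau>' l' s =
      y - r * real (card (insert i J)) * x + pool_loss r J \<tau> l (s - x)" if s: "x \<le> s" for s
  proof -
    have "(\<Sum>j\<in>J. (if \<tau>' j \<le> s then l' j else 0) - r * min (\<tau>' j) s) =
        (\<Sum>j\<in>J. ((if \<tau> j \<le> s - x then l j else 0) - r * min (\<tau> j) (s - x)) - r * x)"
    proof (rule sum.cong)
      fix j assume j: "j \<in> J"
      have "min (\<tau>' j) s = min (\<tau> j) (s - x) + x" using \<tau>'(2)[OF j] by (simp add: min_def)
      then show "(if \<tau>' j \<le> s then l' j else 0) - r * min (\<tau>' j) s =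
          ((if \<tau> j \<le> s - x then l j else 0) - r * min (\<tau> j) (s - x)) - r * x"
        using \<tau>'(2)[OF j] l'(2)[OF j] by (simp add: algebra_simps)
    qed simp
    also have "\<dots> = pool_loss r J \<tau> l (s - x) - real (card J) * (r * x)"
      by (simp add: pool_loss_def sum_subtractf)
    finally show ?thesis
      using I s \<tau>'(1) l'(1) by (simp add: pool_loss_def algebra_simps)
  qed
  show ?thesis
  proof
    assume "ruined r (insert i J) \<tau>' l' u t"
    then obtain s where s: "0 \<le> s" "s \<le> t" "u \<le> pool_loss r (insert i J) \<tau>' l' s"
      by (auto simp: ruined_def)
    then have "x \<le> s" using before[of s] u by linarith
    then show "ruined r J \<tau> l (u + r * real (card (insert i J)) * x - y) (t - x)"
      unfolding ruined_def using s after[of s] by (intro bexI[of _ "s - x"]) auto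
  next
    assume "ruined r J \<tau> l (u + r * real (card (insert i J)) * x - y) (t - x)"
    then obtain s where s: "0 \<le> s" "s \<le> t - x"
        "u + r * real (card (insert i J)) * x - y \<le> pool_loss r J \<tau> l s"
      by (auto simp: ruined_def)
    then show "ruined r (insert i J) \<tau>' l' u t"
      unfolding ruined_def using x after[of "s + x"] by (intro bexI[of _ "s + x"]) auto
  qed
qed

lemma ball_insert_fun_upd:
  assumes "i \<notin> J"
  shows "(\<forall>j\<in>insert i J. x \<le> (\<tau>(i := y)) j) \<longleftrightarrow> (\<forall>j\<in>J. x \<le> \<tau> j) \<and> x \<le> y"
proof -
  have "(\<forall>j\<in>J. x \<le> (\<tau>(i := y)) j) \<longleftrightarrow> (\<forall>j\<in>J. x \<le> \<tau> j)"
    using assms by (intro ball_cong refl) auto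
  then show ?thesis by (simp only: Set.ball_simps fun_upd_same conj_commute)
qed

section \<open>Memoryless default times\<close>

text \<open>
  The parameters of the model and the law \<open>Q\<close> of a single loss, without any random variables: ruin
  probabilities are computed on products of the two one-dimensional laws.
\<close>

locale risk_model =
  fixes lam r \<theta> :: real and Q :: "real measure"
  assumes lam: "0 < lam" and r: "0 < r" and \<theta>: "0 < \<theta>"
    and prob_space_Q: "prob_space Q" and sets_Q: "sets Q = sets borel"
    and Q_nonneg: "AE y in Q. 0 \<le> y"
begin

abbreviation default_law :: "real measure" where
  "default_law \<equiv> density lborel (exponential_density lam)"

sublocale default: prob_space default_law using lam by (rule prob_space_exponential_density)
sublocale Q: prob_space Q by (rule prob_space_Q)
sublocale default_times: product_prob_space "\<lambda>_. default_law" I for I :: "nat set" ..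
sublocale losses: product_prob_space "\<lambda>_. Q" I for I :: "nat set" ..

lemmas sets_Q' [measurable_cong, simp] = sets_Q
lemma space_Q [simp]: "space Q = UNIV" using sets_eq_imp_space_eq[OF sets_Q] by simp

abbreviation default_times_law :: "nat set \<Rightarrow> (nat \<Rightarrow> real) measure" where "default_times_law J \<equiv> PiM J (\<lambda>_. default_law)"
abbreviation losses_law :: "nat set \<Rightarrow> (nat \<Rightarrow> real) measure" where "losses_law J \<equiv> PiM J (\<lambda>_. Q)"

lemma AE_default_law_pos: "AE x in default_law. 0 < x"
proof -
  have "AE x in lborel. 0 < exponential_density lam x \<longrightarrow> 0 < x"
    using AE_lborel_singleton[of 0]
    by eventually_elim (auto simp: exponential_density_def split: if_splits)
  then show ?thesis by (subst AE_density) (auto simp: ennreal_eq_0_iff)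
qed

lemma AE_default_times_pos: 
  assumes "finite J" shows "AE \<tau> in default_times_law J. \<forall>j\<in>J. 0 < \<tau> j"
  using assms AE_default_law_pos
  by (intro AE_finite_allI AE_PiM_component) (auto intro: default.prob_space_axioms)

lemma nn_integral_default_law:
  assumes [measurable]: "f \<in> borel_measurable borel"
  shows "(\<integral>\<^sup>+x. f x \<partial>default_law) = (\<integral>\<^sup>+x. ennreal (exponential_density lam x) * f x \<partial>lborel)"
  by (rule nn_integral_density) auto

text \<open>
  Lack of memory, in the form in which it is used under an integral.
\<close>

lemma default_law_shift:
  assumes [measurable]: "f \<in> borel_measurable borel" and x: "0 \<le> x"
  shows "(\<integral>\<^sup>+y. (if x \<le> y then f y else 0) \<partial>default_law) =
    ennreal (exp (- lam * x)) * (\<integral>\<^sup>+y. f (y + x) \<partial>default_law)"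
proof -
  have "(\<integral>\<^sup>+y. (if x \<le> y then f y else 0) \<partial>default_law) =
      (\<integral>\<^sup>+y. ennreal (exponential_density lam y) * (if x \<le> y then f y else 0) \<partial>lborel)"
    by (subst nn_integral_default_law) auto
  also have "\<dots> = (\<integral>\<^sup>+y. ennreal (exponential_density lam (x + y)) * (if x \<le> x + y then f (x + y) else 0) \<partial>lborel)"
    by (subst nn_integral_real_affine[where c=1 and t=x]) (auto cong: if_cong)
  also have "\<dots> = (\<integral>\<^sup>+y. ennreal (exp (- lam * x)) * (ennreal (exponential_density lam y) * f (y + x)) \<partial>lborel)"
  proof (rule nn_integral_cong)
    fix y :: real
    have "ennreal (exponential_density lam (x + y)) * (if x \<le> x + y then f (x + y) else 0) =
        ennreal (exp (- lam * x) * exponential_density lam y) * f (y + x)"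
      using x by (auto simp: exponential_density_def exp_add[symmetric] algebra_simps)
    then show "ennreal (exponential_density lam (x + y)) * (if x \<le> x + y then f (x + y) else 0) =
        ennreal (exp (- lam * x)) * (ennreal (exponential_density lam y) * f (y + x))"
      using lam by (simp add: ennreal_mult exponential_density_nonneg mult.assoc)
  qed
  also have "\<dots> = ennreal (exp (- lam * x)) * (\<integral>\<^sup>+y. f (y + x) \<partial>default_law)"
    by (subst nn_integral_cmult) (auto simp: nn_integral_default_law)
  finally show ?thesis .
qed

lemma measurable_default_time: "i \<in> I \<Longrightarrow> f \<in> measurable S (default_times_law I) \<Longrightarrow> (\<lambda>z. f z i) \<in> borel_measurable S"
  using measurable_compose[OF _ measurable_component_singleton[of i I "\<lambda>_. default_law"], of f S] by simp

lemma measurable_loss: "i \<in> I \<Longrightarrow> f \<in> measurable S (losses_law I) \<Longrightarrow> (\<lambda>z. f z i) \<in> borel_measurable S"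
  using measurable_compose[OF _ measurable_component_singleton[of i I "\<lambda>_. Q"], of f S]
  by (simp cong: measurable_cong_sets)

lemma pred_le_all_coords:
  assumes "finite J" and g: "g \<in> borel_measurable (default_times_law J)"
  shows "Measurable.pred (default_times_law J) (\<lambda>\<tau>. \<forall>j\<in>J. g \<tau> \<le> \<tau> j)"
proof (rule pred_intros_finite(3)[OF assms(1)])
  fix j assume "j \<in> J"
  from borel_measurable_le[OF g measurable_default_time[OF this measurable_ident, unfolded id_def]]
  show "Measurable.pred (default_times_law J) (\<lambda>\<tau>. g \<tau> \<le> \<tau> j)" by (simp only: pred_def)
qed

text \<open>
  Lack of memory for a whole pool: on the event that nobody has defaulted before \<open>x\<close>, the residual
  default times are distributed as the original ones. The coordinates are treated one at a time by induction.
\<close>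

lemma default_times_shift:
  assumes "finite J" and x: "0 \<le> x" and "f \<in> borel_measurable (default_times_law J)"
  shows "(\<integral>\<^sup>+\<tau>. (if \<forall>j\<in>J. x \<le> \<tau> j then f \<tau> else 0) \<partial>default_times_law J) =
    ennreal (exp (- lam * real (card J) * x)) * (\<integral>\<^sup>+\<tau>. f (\<lambda>j\<in>J. \<tau> j + x) \<partial>default_times_law J)"
  using assms(1,3)
proof (induction J arbitrary: f rule: finite_induct)
  case empty
  show ?case
    by (simp add: PiM_empty nn_integral_count_space_finite restrict_def)
next
  case (insert i J)
  note [measurable] = insert.prems
  note fin = insert.hyps
  have [simp]: "i \<notin> J" "finite J" by fact+
  have "(\<integral>\<^sup>+\<tau>. (if \<forall>j\<in>insert i J. x \<le> \<tau> j then f \<tau> else 0) \<partial>default_times_law (insert i J)) =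
      (\<integral>\<^sup>+\<tau>. (\<integral>\<^sup>+y. (if \<forall>j\<in>insert i J. x \<le> (\<tau>(i:=y)) j then f (\<tau>(i:=y)) else 0) \<partial>default_law) \<partial>default_times_law J)"
  proof (rule default_times.product_nn_integral_insert)
    show "(\<lambda>\<tau>. if \<forall>j\<in>insert i J. x \<le> \<tau> j then f \<tau> else 0) \<in> borel_measurable (default_times_law (insert i J))"
      using pred_le_all_coords[of "insert i J" "\<lambda>_. x"] insert.prems
      by (intro measurable_If) (auto simp: pred_def)
  qed simp_all
  also have "\<dots> = (\<integral>\<^sup>+\<tau>. (if \<forall>j\<in>J. x \<le> \<tau> j
      then (\<integral>\<^sup>+y. (if x \<le> y then f (\<tau>(i:=y)) else 0) \<partial>default_law) else 0) \<partial>default_times_law J)"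
  proof (rule nn_integral_cong)
    fix \<tau>
    note * = ball_insert_fun_upd[OF \<open>i \<notin> J\<close>, of x \<tau>]
    have "(\<integral>\<^sup>+y. (if P \<and> x \<le> y then f (\<tau>(i:=y)) else 0) \<partial>default_law) =
      (if P then (\<integral>\<^sup>+y. (if x \<le> y then f (\<tau>(i:=y)) else 0) \<partial>default_law) else 0)" for P
      by (cases P) simp_all
    then show "(\<integral>\<^sup>+y. (if \<forall>j\<in>insert i J. x \<le> (\<tau>(i:=y)) j then f (\<tau>(i:=y)) else 0) \<partial>default_law) =
      (if \<forall>j\<in>J. x \<le> \<tau> j then (\<integral>\<^sup>+y. (if x \<le> y then f (\<tau>(i:=y)) else 0) \<partial>default_law) else 0)"
      unfolding * .
  qed
  also have "\<dots> = (\<integral>\<^sup>+\<tau>. (if \<forall>j\<in>J. x \<le> \<tau> j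
      then ennreal (exp (- lam * x)) * (\<integral>\<^sup>+y. f (\<tau>(i:=y + x)) \<partial>default_law) else 0) \<partial>default_times_law J)"
  proof (rule nn_integral_cong, rule if_cong[OF refl _ refl])
    fix \<tau> assume \<tau>: "\<tau> \<in> space (default_times_law J)"
    have "(\<lambda>y. \<tau>(i:=y)) \<in> measurable borel (default_times_law (insert i J))"
      using measurable_fun_upd[OF refl measurable_const[OF \<tau>], of "\<lambda>y. y" "borel" i] 
      by (simp add: measurable_def)
    from measurable_compose[OF this insert.prems]
    have "(\<lambda>y. f (\<tau>(i:=y))) \<in> borel_measurable borel" .
    from default_law_shift[OF this x]
    show "(\<integral>\<^sup>+y. (if x \<le> y then f (\<tau>(i:=y)) else 0) \<partial>default_law) =
      ennreal (exp (- lam * x)) * (\<integral>\<^sup>+y. f (\<tau>(i:=y + x)) \<partial>default_law)" .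
  qed
  also have "\<dots> = ennreal (exp (- lam * real (card J) * x)) *
     (\<integral>\<^sup>+\<tau>. ennreal (exp (- lam * x)) * (\<integral>\<^sup>+y. f ((\<lambda>j\<in>J. \<tau> j + x)(i:=y + x)) \<partial>default_law) \<partial>default_times_law J)"
    by (rule insert.IH) measurable
  also have "\<dots> = ennreal (exp (- lam * real (card J) * x)) * (ennreal (exp (- lam * x)) *
     (\<integral>\<^sup>+\<tau>. (\<integral>\<^sup>+y. f ((\<lambda>j\<in>J. \<tau> j + x)(i:=y + x)) \<partial>default_law) \<partial>default_times_law J))"
    by (subst nn_integral_cmult) measurable
  also have "\<dots> = ennreal (exp (- lam * real (card (insert i J)) * x)) *
     (\<integral>\<^sup>+\<tau>. (\<integral>\<^sup>+y. f ((\<lambda>j\<in>J. \<tau> j + x)(i:=y + x)) \<partial>default_law) \<partial>default_times_law J)"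
  proof -
    have "ennreal (exp (- lam * real (card (insert i J)) * x)) =
        ennreal (exp (- lam * real (card J) * x)) * ennreal (exp (- lam * x))"
      by (simp add: ennreal_mult[symmetric] exp_add[symmetric] algebra_simps)
    then show ?thesis by (simp only: mult.assoc)
  qed
  also have "(\<integral>\<^sup>+\<tau>. (\<integral>\<^sup>+y. f ((\<lambda>j\<in>J. \<tau> j + x)(i:=y + x)) \<partial>default_law) \<partial>default_times_law J) =
     (\<integral>\<^sup>+\<tau>. (\<integral>\<^sup>+y. f (\<lambda>j\<in>insert i J. (\<tau>(i:=y)) j + x) \<partial>default_law) \<partial>default_times_law J)"
    using fin(2) by (intro nn_integral_cong arg_cong[where f=f]) (auto simp: fun_eq_iff restrict_def)
  also have "\<dots> = (\<integral>\<^sup>+\<tau>. f (\<lambda>j\<in>insert i J. \<tau> j + x) \<partial>default_times_law (insert i J))"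
    by (subst default_times.product_nn_integral_insert) auto
  finally show ?case .
qed

section \<open>Conditioning on the first default\<close>

text \<open>
  The ruin probability of the pool \<open>I\<close>. It takes values in the extended nonnegative reals, so that iterated integrals
  can be exchanged freely.
\<close>

definition pool_ruin :: "nat set \<Rightarrow> real \<Rightarrow> real \<Rightarrow> ennreal" where
  "pool_ruin I u t = (\<integral>\<^sup>+\<tau>. (\<integral>\<^sup>+l. (if ruined r I \<tau> l u t then 1 else 0) \<partial>losses_law I) \<partial>default_times_law I)"

lemma borel_measurable_ruined:
  assumes "finite I" "\<tau> \<in> measurable S (default_times_law I)" "l \<in> measurable S (losses_law I)"
    "u \<in> borel_measurable S" "t \<in> borel_measurable S"
  shows "(\<lambda>z. if ruined r I (\<tau> z) (l z) (u z) (t z) then 1 else 0 :: ennreal) \<in> borel_measurable S"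
  using pred_ruined[OF assms(1), of r \<tau> S l u t] assms r
    measurable_default_time[of _ I \<tau> S] measurable_loss[of _ I l S]
  by (intro measurable_If) auto

lemma borel_measurable_nn_integral_ruined [measurable (raw)]:
  assumes "finite I" and [measurable]: "\<tau> \<in> measurable S (default_times_law I)" "u \<in> borel_measurable S" "t \<in> borel_measurable S"
  shows "(\<lambda>z. \<integral>\<^sup>+l. (if ruined r I (\<tau> z) l (u z) (t z) then 1 else 0) \<partial>losses_law I) \<in> borel_measurable S"
proof (rule losses.borel_measurable_nn_integral)
  show "(\<lambda>(z, l). if ruined r I (\<tau> z) l (u z) (t z) then 1 else 0 :: ennreal)
      \<in> borel_measurable (S \<Otimes>\<^sub>M losses_law I)"
    unfolding split_beta' by (rule borel_measurable_ruined[OF assms(1)]) measurable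
qed

lemma borel_measurable_pool_ruin [measurable (raw)]:
  assumes "finite I" and [measurable]: "u \<in> borel_measurable S" "t \<in> borel_measurable S"
  shows "(\<lambda>z. pool_ruin I (u z) (t z)) \<in> borel_measurable S"
  unfolding pool_ruin_def
proof (rule default_times.borel_measurable_nn_integral)
  show "(\<lambda>(z, \<tau>). \<integral>\<^sup>+l. (if ruined r I \<tau> l (u z) (t z) then 1 else 0) \<partial>losses_law I)
      \<in> borel_measurable (S \<Otimes>\<^sub>M default_times_law I)"
    unfolding split_beta' by (rule borel_measurable_nn_integral_ruined[OF assms(1)]) measurable
qed

text \<open>
  The exponential law has no atoms, so the obligor who defaults first is almost surely unique.
\<close>

lemma AE_default_times_distinct:
  assumes "finite I"
  shows "AE \<tau> in default_times_law I. \<forall>i\<in>I. \<forall>j\<in>I. i \<noteq> j \<longrightarrow> \<tau> i \<noteq> \<tau> j"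
proof -
  have "AE \<tau> in default_times_law I. \<tau> i \<noteq> \<tau> j" if ij: "i \<in> I" "j \<in> I" "i \<noteq> j" for i j
  proof -
    define J where "J = I - {i}"
    have J: "I = insert i J" "i \<notin> J" "finite J" "j \<in> J" using ij assms by (auto simp: J_def)
    have [measurable]: "(\<lambda>\<tau>. if \<tau> i = \<tau> j then 1 else 0 :: ennreal) \<in> borel_measurable (default_times_law I)"
      using measurable_default_time[OF ij(1) measurable_ident] measurable_default_time[OF ij(2) measurable_ident]
      by (intro measurable_If) auto
    have "(\<integral>\<^sup>+\<tau>. (if \<tau> i = \<tau> j then 1 else 0) \<partial>default_times_law I) =
        (\<integral>\<^sup>+\<tau>. (\<integral>\<^sup>+y. (if (\<tau>(i:=y)) i = (\<tau>(i:=y)) j then 1 else 0) \<partial>default_law) \<partial>default_times_law J)"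
      unfolding J(1) using J by (intro default_times.product_nn_integral_insert) (auto simp flip: J(1))
    also have "\<dots> = (\<integral>\<^sup>+\<tau>. 0 \<partial>default_times_law J)"
    proof (rule nn_integral_cong)
      fix \<tau>
      have "AE y in default_law. y \<noteq> \<tau> j"
        using AE_lborel_singleton[of "\<tau> j"] by (subst AE_density) auto
      then have "(\<integral>\<^sup>+y. (if (\<tau>(i:=y)) i = (\<tau>(i:=y)) j then 1 else 0) \<partial>default_law) = (\<integral>\<^sup>+y. 0 \<partial>default_law)"
        using ij(3) by (intro nn_integral_cong_AE) (auto elim!: eventually_mono)
      then show "(\<integral>\<^sup>+y. (if (\<tau>(i:=y)) i = (\<tau>(i:=y)) j then 1 else 0) \<partial>default_law) = 0" by simp
    qed
    finally have "(\<integral>\<^sup>+\<tau>. (if \<tau> i = \<tau> j then 1 else 0) \<partial>default_times_law I) = 0" by simp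
    then have "AE \<tau> in default_times_law I. (if \<tau> i = \<tau> j then 1 else 0 :: ennreal) = 0"
      by (subst (asm) nn_integral_0_iff_AE) auto
    then show ?thesis by (auto elim!: eventually_mono split: if_splits)
  qed
  then show ?thesis
    using assms by (intro AE_finite_allI) auto
qed

text \<open>
  Default times are almost surely positive, so the net loss at time \<open>0\<close> is \<open>0\<close>, which already reaches a nonpositive \<open>u\<close>.
  In the recursion this is the case of ruin at the first default.
\<close>

lemma pool_ruin_nonpos:
  assumes "finite I" "u \<le> 0" "0 \<le> t"
  shows "pool_ruin I u t = 1"
proof -
  have "pool_ruin I u t = (\<integral>\<^sup>+\<tau>. (\<integral>\<^sup>+l. 1 \<partial>losses_law I) \<partial>default_times_law I)"
    unfolding pool_ruin_def using AE_default_times_pos[OF assms(1)]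
    by (intro nn_integral_cong_AE) (auto elim!: eventually_mono intro!: nn_integral_cong simp: ruined_at_time_0 assms)
  then show ?thesis by (simp add: default_times.emeasure_space_1 losses.emeasure_space_1)
qed

lemma pool_ruin_le_1: "pool_ruin I u t \<le> 1"
proof -
  have "pool_ruin I u t \<le> (\<integral>\<^sup>+\<tau>. (\<integral>\<^sup>+l. 1 \<partial>losses_law I) \<partial>default_times_law I)"
    unfolding pool_ruin_def by (intro nn_integral_mono) auto
  then show ?thesis by (simp add: default_times.emeasure_space_1 losses.emeasure_space_1)
qed

lemma pool_ruin_negative_horizon: "t < 0 \<Longrightarrow> pool_ruin I u t = 0"
  by (simp add: pool_ruin_def ruined_negative_horizon)

lemma pool_ruin_empty: "pool_ruin {} u t = (if 0 \<le> t \<and> u \<le> 0 then 1 else 0)"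
  by (simp add: pool_ruin_def ruined_empty default_times.emeasure_space_1 losses.emeasure_space_1)

text \<open>
  The indicator of ruin is split over the obligor \<open>i\<close> who defaults first. For fixed \<open>i\<close>, its default time \<open>x\<close>
  and loss \<open>y\<close> are integrated last; the condition that all others default later contributes
  \<open>exp (- \<lambda> (card I - 1) x)\<close> by \<open>default_times_shift\<close>, and \<open>ruined_first_default\<close>
  identifies what is left as ruin of the pool \<open>I - {i}\<close>.
\<close>

lemma pool_ruin_first_default:
  assumes I: "finite I" and u: "0 < u"
  shows "pool_ruin I u t = (\<Sum>i\<in>I. \<integral>\<^sup>+x. ennreal (exp (- lam * real (card I - 1) * x)) *
    (\<integral>\<^sup>+y. pool_ruin (I - {i}) (u + r * real (card I) * x - y) (t - x) \<partial>Q) \<partial>default_law)"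
proof (cases "I = {}")
  case True
  with u show ?thesis by (simp add: pool_ruin_empty)
next
  case False
  define G where "G \<tau> = (\<integral>\<^sup>+l. (if ruined r I \<tau> l u t then 1 else 0) \<partial>losses_law I)" for \<tau>
  have G [measurable]: "G \<in> borel_measurable (default_times_law I)"
    unfolding G_def by (rule borel_measurable_nn_integral_ruined[OF I]) auto
  have meas_min: "(\<lambda>\<tau>. if \<forall>j\<in>I. \<tau> i \<le> \<tau> j then G \<tau> else 0) \<in> borel_measurable (default_times_law I)" if "i \<in> I" for i
    using pred_le_all_coords[OF I measurable_default_time[OF that measurable_ident, unfolded id_def]] G
    by (intro measurable_If) (auto simp: pred_def)
  have "pool_ruin I u t = (\<integral>\<^sup>+\<tau>. (\<Sum>i\<in>I. if \<forall>j\<in>I. \<tau> i \<le> \<tau> j then G \<tau> else 0) \<partial>default_times_law I)"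
    unfolding pool_ruin_def G_def[symmetric]
  proof (rule nn_integral_cong_AE)
    show "AE \<tau> in default_times_law I. G \<tau> = (\<Sum>i\<in>I. if \<forall>j\<in>I. \<tau> i \<le> \<tau> j then G \<tau> else 0)"
      using AE_default_times_distinct[OF I]
    proof eventually_elim
      fix \<tau> :: "nat \<Rightarrow> real" assume dist: "\<forall>i\<in>I. \<forall>j\<in>I. i \<noteq> j \<longrightarrow> \<tau> i \<noteq> \<tau> j"
      obtain i0 where i0: "i0 \<in> I" "\<forall>j\<in>I. \<tau> i0 \<le> \<tau> j"
        using ex_is_arg_min_if_finite[OF I False, of \<tau>] by (auto simp: is_arg_min_linorder)
      \<comment> \<open>Without ties, exactly one summand is nonzero.\<close>
      have "(\<Sum>i\<in>I. if \<forall>j\<in>I. \<tau> i \<le> \<tau> j then G \<tau> else 0) = (\<Sum>i\<in>I. if i = i0 then G \<tau> else 0)"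
      proof (rule sum.cong[OF refl])
        fix i assume "i \<in> I"
        then have "i = i0" if "\<forall>j\<in>I. \<tau> i \<le> \<tau> j"
          using dist i0 order.antisym[of "\<tau> i" "\<tau> i0"] that by blast
        then have "(\<forall>j\<in>I. \<tau> i \<le> \<tau> j) \<longleftrightarrow> i = i0" using i0 by blast
        then show "(if \<forall>j\<in>I. \<tau> i \<le> \<tau> j then G \<tau> else 0) = (if i = i0 then G \<tau> else 0)" by simp
      qed
      then show "G \<tau> = (\<Sum>i\<in>I. if \<forall>j\<in>I. \<tau> i \<le> \<tau> j then G \<tau> else 0)"
        using i0 I by simp
    qed
  qed
  also have "\<dots> = (\<Sum>i\<in>I. \<integral>\<^sup>+\<tau>. (if \<forall>j\<in>I. \<tau> i \<le> \<tau> j then G \<tau> else 0) \<partial>default_times_law I)"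
    by (rule nn_integral_sum) (rule meas_min)
  also have "\<dots> = (\<Sum>i\<in>I. \<integral>\<^sup>+x. ennreal (exp (- lam * real (card I - 1) * x)) *
    (\<integral>\<^sup>+y. pool_ruin (I - {i}) (u + r * real (card I) * x - y) (t - x) \<partial>Q) \<partial>default_law)"
  proof (rule sum.cong[OF refl])
    fix i assume i: "i \<in> I"
    define J where "J = I - {i}"
    have J: "I = insert i J" "i \<notin> J" "finite J" using i I by (auto simp: J_def)
    have card: "card I - 1 = card J" using J by simp
    have "(\<integral>\<^sup>+\<tau>. (if \<forall>j\<in>I. \<tau> i \<le> \<tau> j then G \<tau> else 0) \<partial>default_times_law I) =
        (\<integral>\<^sup>+x. \<integral>\<^sup>+\<tau>. (if \<forall>j\<in>I. (\<tau>(i:=x)) i \<le> (\<tau>(i:=x)) j then G (\<tau>(i:=x)) else 0) \<partial>default_times_law J \<partial>default_law)"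
      using meas_min[OF i] J default_times.product_nn_integral_insert_rev[OF J(3,2)] by simp
    also have "\<dots> = (\<integral>\<^sup>+x. ennreal (exp (- lam * real (card I - 1) * x)) *
        (\<integral>\<^sup>+y. pool_ruin J (u + r * real (card I) * x - y) (t - x) \<partial>Q) \<partial>default_law)"
    proof (rule nn_integral_cong_AE)
      show "AE x in default_law. (\<integral>\<^sup>+\<tau>. (if \<forall>j\<in>I. (\<tau>(i:=x)) i \<le> (\<tau>(i:=x)) j then G (\<tau>(i:=x)) else 0) \<partial>default_times_law J) =
         ennreal (exp (- lam * real (card I - 1) * x)) *
        (\<integral>\<^sup>+y. pool_ruin J (u + r * real (card I) * x - y) (t - x) \<partial>Q)"
        using AE_default_law_pos
      proof eventually_elim
        fix x :: real assume x: "0 < x"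
        have upd: "(\<lambda>\<tau>. \<tau>(i:=x)) \<in> measurable (default_times_law J) (default_times_law I)"
          unfolding J(1) by (rule measurable_fun_upd[where J=J]) (auto simp: J)
        note Gupd = measurable_compose[OF upd G]
        have "(\<forall>j\<in>I. (\<tau>(i:=x)) i \<le> (\<tau>(i:=x)) j) \<longleftrightarrow> (\<forall>j\<in>J. x \<le> \<tau> j)" for \<tau>
          unfolding J(1) using ball_insert_fun_upd[OF J(2), of x \<tau> x] by simp
        then have "(\<integral>\<^sup>+\<tau>. (if \<forall>j\<in>I. (\<tau>(i:=x)) i \<le> (\<tau>(i:=x)) j then G (\<tau>(i:=x)) else 0) \<partial>default_times_law J) =
           (\<integral>\<^sup>+\<tau>. (if \<forall>j\<in>J. x \<le> \<tau> j then G (\<tau>(i:=x)) else 0) \<partial>default_times_law J)" by simp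
        also have "\<dots> = ennreal (exp (- lam * real (card J) * x)) *
            (\<integral>\<^sup>+\<tau>. G ((\<lambda>j\<in>J. \<tau> j + x)(i:=x)) \<partial>default_times_law J)"
          using J(3) x Gupd by (intro default_times_shift) auto
        also have "(\<integral>\<^sup>+\<tau>. G ((\<lambda>j\<in>J. \<tau> j + x)(i:=x)) \<partial>default_times_law J) =
           (\<integral>\<^sup>+\<tau>. \<integral>\<^sup>+y. \<integral>\<^sup>+l. (if ruined r J \<tau> l (u + r * real (card I) * x - y) (t - x) then 1 else 0) \<partial>losses_law J \<partial>Q \<partial>default_times_law J)"
        proof (rule nn_integral_cong_AE)
          show "AE \<tau> in default_times_law J. G ((\<lambda>j\<in>J. \<tau> j + x)(i:=x)) =
            (\<integral>\<^sup>+y. \<integral>\<^sup>+l. (if ruined r J \<tau> l (u + r * real (card I) * x - y) (t - x) then 1 else 0) \<partial>losses_law J \<partial>Q)"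
            using AE_default_times_pos[OF J(3)] AE_space
          proof eventually_elim
            fix \<tau> assume pos: "\<forall>j\<in>J. 0 < \<tau> j" and \<tau>: "\<tau> \<in> space (default_times_law J)"
            let ?\<tau> = "(\<lambda>j\<in>J. \<tau> j + x)(i:=x)"
            have sp: "?\<tau> \<in> space (default_times_law I)" by (auto simp: space_PiM J(1) PiE_def extensional_def)
            have "(\<lambda>l. if ruined r I ?\<tau> l u t then 1 else 0 :: ennreal) \<in> borel_measurable (losses_law I)"
              by (rule borel_measurable_ruined[OF I]) (auto simp: sp)
            then have "G ?\<tau> = (\<integral>\<^sup>+y. \<integral>\<^sup>+l. (if ruined r I ?\<tau> (l(i:=y)) u t then 1 else 0) \<partial>losses_law J \<partial>Q)"
              unfolding G_def using losses.product_nn_integral_insert_rev[OF J(3,2)] J(1) by simp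
            also have "\<dots> = (\<integral>\<^sup>+y. \<integral>\<^sup>+l. (if ruined r J \<tau> l (u + r * real (card I) * x - y) (t - x) then 1 else 0) \<partial>losses_law J \<partial>Q)"
            proof (intro nn_integral_cong)
              fix y l
              have "ruined r I ?\<tau> (l(i:=y)) u t \<longleftrightarrow> ruined r J \<tau> l (u + r * real (card I) * x - y) (t - x)"
                unfolding J(1) using x u r pos J
                by (intro ruined_first_default) auto
              then show "(if ruined r I ?\<tau> (l(i:=y)) u t then 1 else 0) =
                (if ruined r J \<tau> l (u + r * real (card I) * x - y) (t - x) then 1 else 0 :: ennreal)" by simp
            qed
            finally show "G ?\<tau> = (\<integral>\<^sup>+y. \<integral>\<^sup>+l. (if ruined r J \<tau> l (u + r * real (card I) * x - y) (t - x) then 1 else 0) \<partial>losses_law J \<partial>Q)" .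
          qed
        qed
        also have "\<dots> = (\<integral>\<^sup>+y. pool_ruin J (u + r * real (card I) * x - y) (t - x) \<partial>Q)"
        proof -
          interpret pair_sigma_finite "default_times_law J" Q ..
          show ?thesis
            unfolding pool_ruin_def
          proof (rule Fubini'[symmetric])
            show "(\<lambda>(\<tau>, y). \<integral>\<^sup>+l. (if ruined r J \<tau> l (u + r * real (card I) * x - y) (t - x) then 1 else 0) \<partial>losses_law J)
               \<in> borel_measurable (default_times_law J \<Otimes>\<^sub>M Q)"
              unfolding split_beta' by (rule borel_measurable_nn_integral_ruined[OF J(3)]) measurable
          qed
        qed
        finally show "(\<integral>\<^sup>+\<tau>. (if \<forall>j\<in>I. (\<tau>(i:=x)) i \<le> (\<tau>(i:=x)) j then G (\<tau>(i:=x)) else 0) \<partial>default_times_law J) =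
         ennreal (exp (- lam * real (card I - 1) * x)) *
        (\<integral>\<^sup>+y. pool_ruin J (u + r * real (card I) * x - y) (t - x) \<partial>Q)" by (simp only: card)
      qed
    qed
    finally show "(\<integral>\<^sup>+\<tau>. (if \<forall>j\<in>I. \<tau> i \<le> \<tau> j then G \<tau> else 0) \<partial>default_times_law I) =
      (\<integral>\<^sup>+x. ennreal (exp (- lam * real (card I - 1) * x)) *
        (\<integral>\<^sup>+y. pool_ruin (I - {i}) (u + r * real (card I) * x - y) (t - x) \<partial>Q) \<partial>default_law)" by (simp add: J_def)
  qed
  finally show ?thesis .
qed

text \<open>
  Exchangeability of the obligors, obtained from \<open>pool_ruin_first_default\<close> by induction: all summands there
  concern pools of the same smaller size, hence agree.
\<close>

lemma pool_ruin_cong_card: 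
  assumes "finite I" "finite J" "card I = card J"
  shows "pool_ruin I u t = pool_ruin J u t"
  using assms
proof (induction "card I" arbitrary: I J u t)
  case 0
  then show ?case by simp
next
  case (Suc n)
  show ?case
  proof (cases "u \<le> 0 \<or> t < 0")
    case True
    then show ?thesis using Suc.prems pool_ruin_nonpos[of _ u t] pool_ruin_negative_horizon[of t]
      by (metis not_le)
  next
    case False
    obtain i0 where i0: "i0 \<in> I" using Suc by fastforce
    define c where "c = (\<integral>\<^sup>+x. ennreal (exp (- lam * real (card I - 1) * x)) *
      (\<integral>\<^sup>+y. pool_ruin (I - {i0}) (u + r * real (card I) * x - y) (t - x) \<partial>Q) \<partial>default_law)"
    have "pool_ruin (K - {i}) v s = pool_ruin (I - {i0}) v s" if "finite K" "card K = card I" "i \<in> K" for K i v s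
    proof (rule Suc.hyps(1)[symmetric])
      show "n = card (I - {i0})" using Suc.hyps(2) i0 Suc.prems by simp
    qed (use that i0 Suc.prems in auto)
    then have "pool_ruin K u t = (\<Sum>i\<in>K. c)" if "finite K" "card K = card I" for K
      using that False by (subst pool_ruin_first_default) (auto simp: c_def intro!: sum.cong)
    from this[of I] this[of J] show ?thesis using Suc.prems by simp
  qed
qed

text \<open>
  The \<open>n\<close> equal summands of \<open>pool_ruin_first_default\<close> and the exponential density of the first defaulter combine into the
  density \<open>\<lambda> n exp (- \<lambda> n x)\<close> of the minimum of \<open>n\<close> default times.
\<close>

lemma pool_ruin_recursion:
  assumes "0 < u" "1 \<le> n"
  shows "pool_ruin {1..n} u t = ennreal (lam * real n) * (\<integral>\<^sup>+x. indicator {0..} x * ennreal (exp (- lam * real n * x)) *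
    (\<integral>\<^sup>+y. pool_ruin {1..n - 1} (u + r * real n * x - y) (t - x) \<partial>Q) \<partial>lborel)"
proof -
  let ?h = "\<lambda>x. \<integral>\<^sup>+y. pool_ruin {1..n - 1} (u + r * real n * x - y) (t - x) \<partial>Q"
  have [measurable]: "?h \<in> borel_measurable borel"
  proof (rule Q.borel_measurable_nn_integral)
    show "(\<lambda>(x, y). pool_ruin {1..n - 1} (u + r * real n * x - y) (t - x)) \<in> borel_measurable (borel \<Otimes>\<^sub>M Q)"
      unfolding split_beta' by (rule borel_measurable_pool_ruin) measurable
  qed
  have n1: "real (n - Suc 0) = real n - 1" using assms by simp
  have "pool_ruin {1..n} u t = (\<Sum>i\<in>{1..n}. \<integral>\<^sup>+x. ennreal (exp (- lam * real (n - 1) * x)) *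
      (\<integral>\<^sup>+y. pool_ruin ({1..n} - {i}) (u + r * real n * x - y) (t - x) \<partial>Q) \<partial>default_law)"
    using pool_ruin_first_default[OF _ assms(1), of "{1..n}" t] by simp
  also have "\<dots> = (\<Sum>i\<in>{1..n}. \<integral>\<^sup>+x. ennreal (exp (- lam * real (n - 1) * x)) * ?h x \<partial>default_law)"
  proof (rule sum.cong[OF refl])
    fix i assume "i \<in> {1..n}"
    then have "pool_ruin ({1..n} - {i}) v s = pool_ruin {1..n - 1} v s" for v s
      by (intro pool_ruin_cong_card) auto
    then show "(\<integral>\<^sup>+x. ennreal (exp (- lam * real (n - 1) * x)) *
      (\<integral>\<^sup>+y. pool_ruin ({1..n} - {i}) (u + r * real n * x - y) (t - x) \<partial>Q) \<partial>default_law) =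
      (\<integral>\<^sup>+x. ennreal (exp (- lam * real (n - 1) * x)) * ?h x \<partial>default_law)" by simp
  qed
  also have "\<dots> = ennreal (real n) * (\<integral>\<^sup>+x. ennreal (exp (- lam * real (n - 1) * x)) * ?h x \<partial>default_law)"
    by (subst sum_constant) (simp add: ennreal_of_nat_eq_real_of_nat)
  also have "(\<integral>\<^sup>+x. ennreal (exp (- lam * real (n - 1) * x)) * ?h x \<partial>default_law) =
    (\<integral>\<^sup>+x. ennreal (exponential_density lam x) * (ennreal (exp (- lam * real (n - 1) * x)) * ?h x) \<partial>lborel)"
    by (rule nn_integral_default_law) measurable
  also have "\<dots> = (\<integral>\<^sup>+x. ennreal lam * (indicator {0..} x * ennreal (exp (- lam * real n * x)) * ?h x) \<partial>lborel)"
  proof (rule nn_integral_cong)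
    fix x :: real
    have "ennreal (exponential_density lam x) * ennreal (exp (- lam * real (n - 1) * x)) =
        ennreal lam * (indicator {0..} x * ennreal (exp (- lam * real n * x)))"
    proof (cases "x < 0")
      case False
      have "exp (- x * lam) * exp (- lam * real (n - 1) * x) = exp (- lam * real n * x)"
        by (simp add: exp_add[symmetric] n1 algebra_simps)
      then have "lam * exp (- x * lam) * exp (- lam * real (n - 1) * x) = lam * exp (- lam * real n * x)"
        by (simp only: mult.assoc)
      then show ?thesis
        using False lam by (simp add: exponential_density_def ennreal_mult[symmetric])
    qed (simp add: exponential_density_def)
    then show "ennreal (exponential_density lam x) * (ennreal (exp (- lam * real (n - 1) * x)) * ?h x) =
        ennreal lam * (indicator {0..} x * ennreal (exp (- lam * real n * x)) * ?h x)"
      by (simp only: mult.assoc[symmetric])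
  qed
  also have "\<dots> = ennreal lam * (\<integral>\<^sup>+x. indicator {0..} x * ennreal (exp (- lam * real n * x)) * ?h x \<partial>lborel)"
    by (rule nn_integral_cmult) measurable
  also have "ennreal (real n) * (ennreal lam * X) = ennreal (lam * real n) * X" for X
  proof -
    have "ennreal (lam * real n) = ennreal (real n) * ennreal lam"
      using lam by (subst mult.commute) (simp add: ennreal_mult)
    then show ?thesis by (simp only: mult.assoc)
  qed
  finally show ?thesis .
qed

end

section \<open>Laplace transforms\<close>

lemma nn_integral_exp_half_line:
  assumes "0 < (\<gamma>::real)"
  shows "(\<integral>\<^sup>+v. indicator {0..} v * ennreal (exp (- \<gamma> * v)) \<partial>lborel) = ennreal (1 / \<gamma>)"
proof -
  interpret E: prob_space "density lborel (exponential_density \<gamma>)"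
    using assms by (rule prob_space_exponential_density)
  have "1 = (\<integral>\<^sup>+v. ennreal (exponential_density \<gamma> v) \<partial>lborel)"
    using E.emeasure_space_1 by (simp add: emeasure_density)
  also have "\<dots> = (\<integral>\<^sup>+v. ennreal \<gamma> * (indicator {0..} v * ennreal (exp (- \<gamma> * v))) \<partial>lborel)"
    using assms by (intro nn_integral_cong)
      (auto simp: exponential_density_def ennreal_mult[symmetric] mult.commute)
  also have "\<dots> = ennreal \<gamma> * (\<integral>\<^sup>+v. indicator {0..} v * ennreal (exp (- \<gamma> * v)) \<partial>lborel)"
    by (rule nn_integral_cmult) measurable
  finally have "ennreal (1 / \<gamma>) * 1 = ennreal (1 / \<gamma>) * (ennreal \<gamma> * 
      (\<integral>\<^sup>+v. indicator {0..} v * ennreal (exp (- \<gamma> * v)) \<partial>lborel))" by simp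
  then show ?thesis
    using assms by (simp only: mult.assoc[symmetric]) (simp add: ennreal_mult[symmetric])
qed

lemma nn_integral_exp_interval:
  assumes "\<gamma> \<noteq> (0::real)" "0 \<le> b"
  shows "(\<integral>\<^sup>+v. indicator {0..b} v * ennreal (exp (- \<gamma> * v)) \<partial>lborel) = ennreal ((1 - exp (- \<gamma> * b)) / \<gamma>)"
proof -
  have "(\<integral>\<^sup>+v. ennreal (exp (- \<gamma> * v)) * indicator {0..b} v \<partial>lborel)
      = ennreal (- exp (- \<gamma> * b) / \<gamma> - (- exp (- \<gamma> * 0) / \<gamma>))"
    using assms by (intro nn_integral_FTC_Icc) (auto intro!: derivative_eq_intros)
  also have "- exp (- \<gamma> * b) / \<gamma> - (- exp (- \<gamma> * 0) / \<gamma>) = (1 - exp (- \<gamma> * b)) / \<gamma>"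
    by (simp add: diff_divide_distrib)
  finally show ?thesis by (simp add: mult.commute)
qed

text \<open>
  In the double integral substitute \<open>v = u + c x\<close>. For fixed \<open>v\<close> the variable \<open>x\<close> then runs through
  \<open>{0..v / c}\<close>, and integrating \<open>exp (- \<gamma> (v - c x)) exp (- a x)\<close> over this interval leaves a difference of
  two exponentials. Numerator and denominator have the same sign, so the quotient is nonnegative whichever
  of \<open>\<gamma>\<close> and \<open>a / c\<close> is larger.
\<close>

lemma nn_laplace_ramp:
  fixes h :: "real \<Rightarrow> ennreal" and a c \<gamma> :: real
  assumes [measurable]: "h \<in> borel_measurable borel" and c: "0 < c" and ne: "a \<noteq> c * \<gamma>"
  shows "(\<integral>\<^sup>+u. indicator {0..} u * ennreal (exp (- \<gamma> * u)) *
        (\<integral>\<^sup>+x. indicator {0..} x * ennreal (exp (- a * x)) * h (u + c * x) \<partial>lborel) \<partial>lborel) =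
    (\<integral>\<^sup>+v. h v * (indicator {0..} v * ennreal ((exp (- \<gamma> * v) - exp (- (a / c) * v)) / (a - c * \<gamma>))) \<partial>lborel)"
proof -
  define A where "A \<gamma> v = indicator {0..} v * ennreal (exp (- \<gamma> * v))" for \<gamma> v :: real
  have [measurable]: "A \<gamma> \<in> borel_measurable borel" for \<gamma> unfolding A_def by measurable
  have inner: "(\<integral>\<^sup>+x. A \<gamma> (v - c * x) * A a x \<partial>lborel) =
      indicator {0..} v * ennreal ((exp (- \<gamma> * v) - exp (- (a / c) * v)) / (a - c * \<gamma>))" for v
  proof (cases "0 \<le> v")
    case True
    have "(\<integral>\<^sup>+x. A \<gamma> (v - c * x) * A a x \<partial>lborel) =
        (\<integral>\<^sup>+x. ennreal (exp (- \<gamma> * v)) * (indicator {0..v / c} x * ennreal (exp (- (a - c * \<gamma>) * x))) \<partial>lborel)"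
    proof (rule nn_integral_cong)
      fix x :: real
      have "exp (- \<gamma> * (v - c * x)) * exp (- a * x) = exp (- \<gamma> * v) * exp (- (a - c * \<gamma>) * x)"
        by (simp add: exp_add[symmetric] algebra_simps)
      then have "ennreal (exp (- \<gamma> * (v - c * x))) * ennreal (exp (- a * x)) =
          ennreal (exp (- \<gamma> * v)) * ennreal (exp (- (a - c * \<gamma>) * x))"
        by (simp add: ennreal_mult[symmetric])
      moreover have "x \<le> v / c \<longleftrightarrow> 0 \<le> v - c * x" using c by (simp add: field_simps)
      ultimately show "A \<gamma> (v - c * x) * A a x =
          ennreal (exp (- \<gamma> * v)) * (indicator {0..v / c} x * ennreal (exp (- (a - c * \<gamma>) * x)))"
        by (auto simp: A_def indicator_def)
    qed
    also have "\<dots> = ennreal (exp (- \<gamma> * v)) * ennreal ((1 - exp (- (a - c * \<gamma>) * (v / c))) / (a - c * \<gamma>))"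
    proof -
      have i: "(\<integral>\<^sup>+x. indicator {0..v / c} x * ennreal (exp (- (a - c * \<gamma>) * x)) \<partial>lborel) =
          ennreal ((1 - exp (- (a - c * \<gamma>) * (v / c))) / (a - c * \<gamma>))"
        by (rule nn_integral_exp_interval) (use ne c True in auto)
      show ?thesis by (subst nn_integral_cmult) (measurable, simp only: i)
    qed
    also have "\<dots> = ennreal (exp (- \<gamma> * v) * ((1 - exp (- (a - c * \<gamma>) * (v / c))) / (a - c * \<gamma>)))"
      by (rule ennreal_mult'[symmetric]) simp
    also have "exp (- \<gamma> * v) * ((1 - exp (- (a - c * \<gamma>) * (v / c))) / (a - c * \<gamma>)) =
        (exp (- \<gamma> * v) - exp (- \<gamma> * v) * exp (- (a - c * \<gamma>) * (v / c))) / (a - c * \<gamma>)"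
      by (simp add: algebra_simps)
    also have "exp (- \<gamma> * v) * exp (- (a - c * \<gamma>) * (v / c)) = exp (- (a / c) * v)"
      using c by (simp add: exp_add[symmetric] field_simps)
    finally show ?thesis using True by simp
  next
    case False
    have zero: "A \<gamma> (v - c * x) * A a x = 0" for x
    proof (cases "0 \<le> x")
      case True
      then have "v - c * x < 0" using False c mult_nonneg_nonneg[of c x] by linarith
      then show ?thesis by (simp add: A_def)
    qed (simp add: A_def)
    show ?thesis unfolding zero using False by simp
  qed
  have "(\<integral>\<^sup>+u. A \<gamma> u * (\<integral>\<^sup>+x. A a x * h (u + c * x) \<partial>lborel) \<partial>lborel) =
      (\<integral>\<^sup>+u. \<integral>\<^sup>+x. A \<gamma> u * (A a x * h (u + c * x)) \<partial>lborel \<partial>lborel)"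
    by (subst nn_integral_cmult) measurable
  also have "\<dots> = (\<integral>\<^sup>+x. \<integral>\<^sup>+u. A \<gamma> u * (A a x * h (u + c * x)) \<partial>lborel \<partial>lborel)"
    by (rule lborel_pair.Fubini') measurable
  also have "\<dots> = (\<integral>\<^sup>+x. \<integral>\<^sup>+v. h v * (A \<gamma> (v - c * x) * A a x) \<partial>lborel \<partial>lborel)"
  proof (rule nn_integral_cong)
    fix x :: real
    show "(\<integral>\<^sup>+u. A \<gamma> u * (A a x * h (u + c * x)) \<partial>lborel) = (\<integral>\<^sup>+v. h v * (A \<gamma> (v - c * x) * A a x) \<partial>lborel)"
      by (subst nn_integral_real_affine[where c=1 and t="- c * x"])
        (auto intro!: nn_integral_cong simp: mult_ac)
  qed
  also have "\<dots> = (\<integral>\<^sup>+v. \<integral>\<^sup>+x. h v * (A \<gamma> (v - c * x) * A a x) \<partial>lborel \<partial>lborel)"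
    by (rule lborel_pair.Fubini') measurable
  also have "\<dots> = (\<integral>\<^sup>+v. h v * (\<integral>\<^sup>+x. A \<gamma> (v - c * x) * A a x \<partial>lborel) \<partial>lborel)"
    by (subst nn_integral_cmult) measurable
  finally show ?thesis unfolding inner by (simp only: A_def)
qed

definition laplace_on :: "(real \<Rightarrow> ennreal) \<Rightarrow> real \<Rightarrow> ennreal" where
  "laplace_on f \<gamma> = (\<integral>\<^sup>+v. indicator {0..} v * ennreal (exp (- \<gamma> * v)) * f v \<partial>lborel)"

lemma laplace_on_le:
  assumes "\<And>v. f v \<le> 1" "0 < \<gamma>"
  shows "laplace_on f \<gamma> \<le> ennreal (1 / \<gamma>)"
proof -
  have "laplace_on f \<gamma> \<le> (\<integral>\<^sup>+v. indicator {0..} v * ennreal (exp (- \<gamma> * v)) \<partial>lborel)"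
    unfolding laplace_on_def using mult_left_mono[OF assms(1)] by (intro nn_integral_mono) fastforce
  then show ?thesis using nn_integral_exp_half_line[OF assms(2)] by simp
qed

lemma laplace_on_has_integral:
  assumes [measurable]: "f \<in> borel_measurable borel" and "\<And>v. f v \<le> 1" "0 < \<gamma>"
  shows "has_bochner_integral lborel (\<lambda>v. indicator {0..} v * exp (- \<gamma> * v) * enn2real (f v)) (enn2real (laplace_on f \<gamma>))"
proof (rule has_bochner_integral_nn_integral)
  have fin: "laplace_on f \<gamma> < \<top>"
    using laplace_on_le[OF assms(2,3)] by (rule order.strict_trans1) simp
  have f: "ennreal (enn2real (f v)) = f v" for v
    using assms(2)[of v] by (intro ennreal_enn2real) (auto simp: order.strict_trans1[of _ 1])
  have "(\<integral>\<^sup>+v. ennreal (indicator {0..} v * exp (- \<gamma> * v) * enn2real (f v)) \<partial>lborel) = laplace_on f \<gamma>"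
    unfolding laplace_on_def
    by (intro nn_integral_cong) (auto simp: ennreal_mult f indicator_def)
  then show "(\<integral>\<^sup>+v. ennreal (indicator {0..} v * exp (- \<gamma> * v) * enn2real (f v)) \<partial>lborel) =
      ennreal (enn2real (laplace_on f \<gamma>))" using fin by simp
qed auto

text \<open>
  Subtraction of extended nonnegative reals is truncated at \<open>0\<close>, so the difference is formed between real-valued integrals, which are
  finite because \<open>h\<close> is bounded. The condition on the sign of \<open>d\<close> keeps the left integrand nonnegative.
\<close>

lemma laplace_difference:
  fixes h :: "real \<Rightarrow> ennreal" and d :: real
  assumes [measurable]: "h \<in> borel_measurable borel" and h1: "\<And>v. h v \<le> 1"
    and pos: "0 < \<gamma>" "0 < \<alpha>" and d: "d \<noteq> 0" "0 < d \<longleftrightarrow> \<gamma> < \<alpha>"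
  shows "enn2real (\<integral>\<^sup>+v. h v * (indicator {0..} v * ennreal ((exp (- \<gamma> * v) - exp (- \<alpha> * v)) / d)) \<partial>lborel) =
    (enn2real (laplace_on h \<gamma>) - enn2real (laplace_on h \<alpha>)) / d"
proof -
  let ?g = "\<lambda>v. (indicator {0..} v * exp (- \<gamma> * v) * enn2real (h v) -
      indicator {0..} v * exp (- \<alpha> * v) * enn2real (h v)) / d"
  have hv: "ennreal (enn2real (h v)) = h v" for v
    using h1[of v] by (intro ennreal_enn2real) (auto simp: order.strict_trans1[of _ 1])
  have nonneg: "0 \<le> (exp (- \<gamma> * v) - exp (- \<alpha> * v)) / d" if "0 \<le> v" for v
  proof (cases "0 < d")
    case True
    then have "\<gamma> * v \<le> \<alpha> * v" using d that by (intro mult_right_mono) auto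
    with True show ?thesis by simp
  next
    case False
    then have "\<alpha> * v \<le> \<gamma> * v" using d that by (intro mult_right_mono) auto
    with False show ?thesis by (simp add: divide_nonpos_nonpos)
  qed
  have hb: "has_bochner_integral lborel ?g ((enn2real (laplace_on h \<gamma>) - enn2real (laplace_on h \<alpha>)) / d)"
    by (intro has_bochner_integral_divide has_bochner_integral_diff laplace_on_has_integral) (auto simp: h1 pos d)
  have g: "?g v = indicator {0..} v * ((exp (- \<gamma> * v) - exp (- \<alpha> * v)) / d) * enn2real (h v)" for v
    by (auto simp: indicator_def left_diff_distrib)
  have gnn: "0 \<le> ?g v" for v
  proof -
    have "0 \<le> indicator {0..} v * ((exp (- \<gamma> * v) - exp (- \<alpha> * v)) / d)"
      using nonneg[of v] by (simp add: indicator_def)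
    then show ?thesis unfolding g by (rule mult_nonneg_nonneg) simp
  qed
  have "(enn2real (laplace_on h \<gamma>) - enn2real (laplace_on h \<alpha>)) / d = (LINT v|lborel. ?g v)"
    using hb by (rule has_bochner_integral_integral_eq[symmetric])
  also have "\<dots> = enn2real (\<integral>\<^sup>+v. ennreal (?g v) \<partial>lborel)"
    using gnn by (intro integral_eq_nn_integral) auto
  also have "(\<integral>\<^sup>+v. ennreal (?g v) \<partial>lborel) =
      (\<integral>\<^sup>+v. h v * (indicator {0..} v * ennreal ((exp (- \<gamma> * v) - exp (- \<alpha> * v)) / d)) \<partial>lborel)"
  proof (rule nn_integral_cong)
    fix v :: real
    show "ennreal (?g v) = h v * (indicator {0..} v * ennreal ((exp (- \<gamma> * v) - exp (- \<alpha> * v)) / d))"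
      unfolding g
      using nonneg[of v] by (cases "0 \<le> v") (simp_all add: ennreal_mult hv mult.commute del: times_divide_eq_left times_divide_eq_right)
  qed
  finally show ?thesis by simp
qed

section \<open>Ruin before an exponential time\<close>

context risk_model begin

definition killed_ruin :: "nat \<Rightarrow> real \<Rightarrow> ennreal" where
  "killed_ruin n u = (\<integral>\<^sup>+t. indicator {0..} t * ennreal (\<theta> * exp (- \<theta> * t)) * pool_ruin {1..n} u t \<partial>lborel)"

lemma borel_measurable_killed_ruin [measurable]: "killed_ruin n \<in> borel_measurable borel"
  unfolding killed_ruin_def
proof (rule lborel.borel_measurable_nn_integral)
  show "(\<lambda>(u, t). indicator {0..} t * ennreal (\<theta> * exp (- \<theta> * t)) * pool_ruin {1..n} u t)
      \<in> borel_measurable (borel \<Otimes>\<^sub>M lborel)" by measurable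
qed

lemma nn_integral_killing:
  "(\<integral>\<^sup>+t. indicator {0..} t * ennreal (\<theta> * exp (- \<theta> * t)) \<partial>lborel) = 1"
proof -
  have "(\<integral>\<^sup>+t. indicator {0..} t * ennreal (\<theta> * exp (- \<theta> * t)) \<partial>lborel) =
      (\<integral>\<^sup>+t. ennreal \<theta> * (indicator {0..} t * ennreal (exp (- \<theta> * t))) \<partial>lborel)"
    using \<theta> by (intro nn_integral_cong) (simp add: ennreal_mult mult.left_commute)
  also have "\<dots> = ennreal \<theta> * ennreal (1 / \<theta>)"
    by (subst nn_integral_cmult) (measurable, simp only: nn_integral_exp_half_line[OF \<theta>])
  also have "\<dots> = 1" using \<theta> by (simp add: ennreal_mult[symmetric])
  finally show ?thesis .
qed

lemma killed_ruin_le_1: "killed_ruin n u \<le> 1"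
proof -
  have "killed_ruin n u \<le> (\<integral>\<^sup>+t. indicator {0..} t * ennreal (\<theta> * exp (- \<theta> * t)) \<partial>lborel)"
    unfolding killed_ruin_def using mult_left_mono[OF pool_ruin_le_1] by (intro nn_integral_mono) fastforce
  then show ?thesis by (simp only: nn_integral_killing)
qed

lemma killed_ruin_nonpos: "u \<le> 0 \<Longrightarrow> killed_ruin n u = 1"
proof -
  assume u: "u \<le> 0"
  have "killed_ruin n u = (\<integral>\<^sup>+t. indicator {0..} t * ennreal (\<theta> * exp (- \<theta> * t)) \<partial>lborel)"
    unfolding killed_ruin_def using u pool_ruin_nonpos[of "{1..n}" u] by (intro nn_integral_cong) (auto simp: indicator_def)
  then show ?thesis by (simp only: nn_integral_killing)
qed

text \<open>
  The exponential killing time is memoryless as well: surviving the first \<open>x\<close> time units costs \<open>exp (- \<theta> x)\<close>.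
\<close>

lemma killing_shift:
  assumes x: "0 \<le> x"
  shows "(\<integral>\<^sup>+t. indicator {0..} t * ennreal (\<theta> * exp (- \<theta> * t)) * pool_ruin {1..n} u (t - x) \<partial>lborel) =
    ennreal (exp (- \<theta> * x)) * killed_ruin n u"
proof -
  have "(\<integral>\<^sup>+t. indicator {0..} t * ennreal (\<theta> * exp (- \<theta> * t)) * pool_ruin {1..n} u (t - x) \<partial>lborel) =
      (\<integral>\<^sup>+t. indicator {0..} (x + t) * ennreal (\<theta> * exp (- \<theta> * (x + t))) * pool_ruin {1..n} u t \<partial>lborel)"
    by (subst nn_integral_real_affine[where c=1 and t=x]) auto
  also have "\<dots> = (\<integral>\<^sup>+t. ennreal (exp (- \<theta> * x)) *
      (indicator {0..} t * ennreal (\<theta> * exp (- \<theta> * t)) * pool_ruin {1..n} u t) \<partial>lborel)"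
  proof (rule nn_integral_cong)
    fix t :: real
    have "ennreal (\<theta> * exp (- \<theta> * (x + t))) = ennreal (exp (- \<theta> * x) * (\<theta> * exp (- \<theta> * t)))"
      by (simp add: exp_add[symmetric] exp_diff[symmetric] algebra_simps)
    also have "\<dots> = ennreal (exp (- \<theta> * x)) * ennreal (\<theta> * exp (- \<theta> * t))"
      by (rule ennreal_mult') simp
    finally have *: "ennreal (\<theta> * exp (- \<theta> * (x + t))) =
      ennreal (exp (- \<theta> * x)) * ennreal (\<theta> * exp (- \<theta> * t))" .
    show "indicator {0..} (x + t) * ennreal (\<theta> * exp (- \<theta> * (x + t))) * pool_ruin {1..n} u t =
      ennreal (exp (- \<theta> * x)) * (indicator {0..} t * ennreal (\<theta> * exp (- \<theta> * t)) * pool_ruin {1..n} u t)"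
      unfolding * using x pool_ruin_negative_horizon[of t] by (cases "0 \<le> t") (simp_all add: mult.assoc)
  qed
  also have "\<dots> = ennreal (exp (- \<theta> * x)) * killed_ruin n u"
    unfolding killed_ruin_def by (rule nn_integral_cmult) measurable
  finally show ?thesis .
qed

text \<open>
  The ruin probability when a loss is incurred at time \<open>0\<close> and \<open>n\<close> obligors remain.
\<close>

definition claim_ruin :: "nat \<Rightarrow> real \<Rightarrow> ennreal" where
  "claim_ruin n v = (\<integral>\<^sup>+y. killed_ruin n (v - y) \<partial>Q)"

lemma borel_measurable_claim_ruin [measurable]: "claim_ruin n \<in> borel_measurable borel"
  unfolding claim_ruin_def
proof (rule Q.borel_measurable_nn_integral)
  show "(\<lambda>(v, y). killed_ruin n (v - y)) \<in> borel_measurable (borel \<Otimes>\<^sub>M Q)" by measurable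
qed

lemma claim_ruin_le_1: "claim_ruin n v \<le> 1"
proof -
  have "claim_ruin n v \<le> (\<integral>\<^sup>+y. 1 \<partial>Q)" unfolding claim_ruin_def using killed_ruin_le_1 by (intro nn_integral_mono) auto
  then show ?thesis using Q.emeasure_space_1 by simp
qed

sublocale lborel_Q: pair_sigma_finite lborel Q ..

lemma killed_ruin_recursion:
  assumes u: "0 < u" and n: "1 \<le> n"
  shows "killed_ruin n u = ennreal (lam * real n) * (\<integral>\<^sup>+x. indicator {0..} x *
    ennreal (exp (- (lam * real n + \<theta>) * x)) * claim_ruin (n - 1) (u + r * real n * x) \<partial>lborel)"
proof -
  define w where "w t = indicator {0..} t * ennreal (\<theta> * exp (- \<theta> * t))" for t :: real
  define g where "g x = indicator {0..} x * ennreal (exp (- lam * real n * x))" for x :: real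
  define f where "f x t = (\<integral>\<^sup>+y. pool_ruin {1..n - 1} (u + r * real n * x - y) (t - x) \<partial>Q)" for x t
  have [measurable]: "w \<in> borel_measurable borel" "g \<in> borel_measurable borel"
    unfolding w_def g_def by measurable
  have [measurable]: "(\<lambda>(x, t). f x t) \<in> borel_measurable (lborel \<Otimes>\<^sub>M lborel)"
    unfolding f_def
  proof (subst split_beta', rule Q.borel_measurable_nn_integral)
    show "(\<lambda>(z, y). pool_ruin {1..n - 1} (u + r * real n * fst z - y) (snd z - fst z))
        \<in> borel_measurable ((lborel \<Otimes>\<^sub>M lborel) \<Otimes>\<^sub>M Q)"
      unfolding split_beta' by (rule borel_measurable_pool_ruin) measurable
  qed
  have "killed_ruin n u = (\<integral>\<^sup>+t. w t * (ennreal (lam * real n) * (\<integral>\<^sup>+x. g x * f x t \<partial>lborel)) \<partial>lborel)"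
    unfolding killed_ruin_def w_def f_def g_def pool_ruin_recursion[OF u n] ..
  also have "\<dots> = (\<integral>\<^sup>+t. ennreal (lam * real n) * (\<integral>\<^sup>+x. w t * (g x * f x t) \<partial>lborel) \<partial>lborel)"
    by (subst nn_integral_cmult) (auto simp: mult.left_commute)
  also have "\<dots> = ennreal (lam * real n) * (\<integral>\<^sup>+t. \<integral>\<^sup>+x. w t * (g x * f x t) \<partial>lborel \<partial>lborel)"
    by (subst nn_integral_cmult) measurable
  also have "(\<integral>\<^sup>+t. \<integral>\<^sup>+x. w t * (g x * f x t) \<partial>lborel \<partial>lborel) =
      (\<integral>\<^sup>+x. \<integral>\<^sup>+t. w t * (g x * f x t) \<partial>lborel \<partial>lborel)"
    by (rule lborel_pair.Fubini') measurable
  also have "\<dots> = (\<integral>\<^sup>+x. g x * (\<integral>\<^sup>+t. w t * f x t \<partial>lborel) \<partial>lborel)"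
    by (subst nn_integral_cmult[symmetric]) (auto simp: mult.left_commute)
  also have "\<dots> = (\<integral>\<^sup>+x. indicator {0..} x *
    ennreal (exp (- (lam * real n + \<theta>) * x)) * claim_ruin (n - 1) (u + r * real n * x) \<partial>lborel)"
  proof (rule nn_integral_cong)
    fix x :: real
    show "g x * (\<integral>\<^sup>+t. w t * f x t \<partial>lborel) = indicator {0..} x *
      ennreal (exp (- (lam * real n + \<theta>) * x)) * claim_ruin (n - 1) (u + r * real n * x)"
    proof (cases "0 \<le> x")
      case True
      have "(\<integral>\<^sup>+t. w t * f x t \<partial>lborel) =
          (\<integral>\<^sup>+t. \<integral>\<^sup>+y. w t * pool_ruin {1..n - 1} (u + r * real n * x - y) (t - x) \<partial>Q \<partial>lborel)"
        unfolding f_def by (intro nn_integral_cong nn_integral_cmult[symmetric]) measurable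
      also have "\<dots> = (\<integral>\<^sup>+y. \<integral>\<^sup>+t. w t * pool_ruin {1..n - 1} (u + r * real n * x - y) (t - x) \<partial>lborel \<partial>Q)"
        by (rule lborel_Q.Fubini'[symmetric]) measurable
      also have "\<dots> = (\<integral>\<^sup>+y. ennreal (exp (- \<theta> * x)) * killed_ruin (n - 1) (u + r * real n * x - y) \<partial>Q)"
        unfolding w_def killing_shift[OF True] ..
      also have "\<dots> = ennreal (exp (- \<theta> * x)) * claim_ruin (n - 1) (u + r * real n * x)"
        unfolding claim_ruin_def by (rule nn_integral_cmult) measurable
      finally have *: "(\<integral>\<^sup>+t. w t * f x t \<partial>lborel) = \<dots>" .
      have "exp (- lam * real n * x) * exp (- \<theta> * x) = exp (- (lam * real n + \<theta>) * x)"
        by (simp add: exp_add[symmetric] algebra_simps)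
      then have "ennreal (exp (- lam * real n * x)) * ennreal (exp (- \<theta> * x)) =
        ennreal (exp (- (lam * real n + \<theta>) * x))"
        by (simp add: ennreal_mult[symmetric])
      with True show ?thesis by (simp add: * g_def mult.assoc[symmetric])
    qed (simp add: g_def)
  qed
  finally show ?thesis .
qed

definition \<psi> :: "nat \<Rightarrow> real \<Rightarrow> real" where
  "\<psi> n \<gamma> = enn2real (laplace_on (killed_ruin n) \<gamma>)"

text \<open>
  \<open>killed_ruin_recursion\<close> fails at \<open>u = 0\<close>, where ruin is immediate, but a single point does not affect the transform.
\<close>

lemma laplace_killed_ruin:
  assumes \<gamma>: "0 < \<gamma>" "\<gamma> \<noteq> (lam * real n + \<theta>) / (r * real n)" and n: "1 \<le> n"
  shows "\<psi> n \<gamma> = lam * real n / (lam * real n + \<theta> - \<gamma> * r * real n) *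
     (enn2real (laplace_on (claim_ruin (n - 1)) \<gamma>) - enn2real (laplace_on (claim_ruin (n - 1)) ((lam * real n + \<theta>) / (r * real n))))"
proof -
  define a where "a = lam * real n + \<theta>"
  define c where "c = r * real n"
  have c: "0 < c" using r n by (simp add: c_def)
  have a: "0 < a" using lam \<theta> n by (simp add: a_def add_pos_pos)
  have ne: "a \<noteq> c * \<gamma>" using \<gamma>(2) c unfolding a_def[symmetric] c_def[symmetric] by (simp add: field_simps)
  have "laplace_on (killed_ruin n) \<gamma> = (\<integral>\<^sup>+u. ennreal (lam * real n) * (indicator {0..} u * ennreal (exp (- \<gamma> * u)) *
      (\<integral>\<^sup>+x. indicator {0..} x * ennreal (exp (- a * x)) * claim_ruin (n - 1) (u + c * x) \<partial>lborel)) \<partial>lborel)"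
    unfolding laplace_on_def
  proof (rule nn_integral_cong_AE)
    show "AE u in lborel. indicator {0..} u * ennreal (exp (- \<gamma> * u)) * killed_ruin n u =
      ennreal (lam * real n) * (indicator {0..} u * ennreal (exp (- \<gamma> * u)) *
      (\<integral>\<^sup>+x. indicator {0..} x * ennreal (exp (- a * x)) * claim_ruin (n - 1) (u + c * x) \<partial>lborel))"
      using AE_lborel_singleton[of 0]
    proof eventually_elim
      fix u :: real assume "u \<noteq> 0"
      then show "indicator {0..} u * ennreal (exp (- \<gamma> * u)) * killed_ruin n u =
        ennreal (lam * real n) * (indicator {0..} u * ennreal (exp (- \<gamma> * u)) *
        (\<integral>\<^sup>+x. indicator {0..} x * ennreal (exp (- a * x)) * claim_ruin (n - 1) (u + c * x) \<partial>lborel))"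
        using killed_ruin_recursion[OF _ n, of u] unfolding a_def[symmetric] c_def[symmetric]
        by (cases "0 < u") (simp_all only: mult.left_commute, simp add: indicator_def)
    qed
  qed
  also have "\<dots> = ennreal (lam * real n) * (\<integral>\<^sup>+v. claim_ruin (n - 1) v * (indicator {0..} v *
      ennreal ((exp (- \<gamma> * v) - exp (- (a / c) * v)) / (a - c * \<gamma>))) \<partial>lborel)"
    by (subst nn_integral_cmult) (measurable, simp only: nn_laplace_ramp[OF borel_measurable_claim_ruin c ne])
  finally have "\<psi> n \<gamma> = lam * real n * enn2real (\<integral>\<^sup>+v. claim_ruin (n - 1) v * (indicator {0..} v *
      ennreal ((exp (- \<gamma> * v) - exp (- (a / c) * v)) / (a - c * \<gamma>))) \<partial>lborel)"
    using lam by (simp add: \<psi>_def enn2real_mult)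
  also have "\<dots> = lam * real n * ((enn2real (laplace_on (claim_ruin (n - 1)) \<gamma>) - enn2real (laplace_on (claim_ruin (n - 1)) (a / c))) / (a - c * \<gamma>))"
    using a c \<gamma> ne by (subst laplace_difference) (auto simp: claim_ruin_le_1 field_simps)
  finally show ?thesis unfolding a_def c_def by (simp add: mult_ac)
qed

text \<open>
  A loss \<open>y\<close> ruins the reserves \<open>v \<le> y\<close> at once, which contributes \<open>(1 - exp (- \<gamma> y)) / \<gamma>\<close>, and turns the
  larger reserves into \<open>v - y\<close>, which contributes \<open>exp (- \<gamma> y) \<psi> n \<gamma>\<close>. Averaging over \<open>y\<close> gives the claim;
  nonnegativity of the losses enters here, since for \<open>y < 0\<close> no reserve is ruined at once and the first term would be negative.
\<close>

lemma laplace_claim_ruin: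
  assumes \<gamma>: "0 < \<gamma>"
  shows "enn2real (laplace_on (claim_ruin n) \<gamma>) =
    1 / \<gamma> - (LINT y|Q. exp (- \<gamma> * y)) * (1 / \<gamma> - \<psi> n \<gamma>)"
proof -
  have claim: "(\<integral>\<^sup>+v. indicator {0..} v * ennreal (exp (- \<gamma> * v)) * killed_ruin n (v - y) \<partial>lborel) =
      ennreal ((1 - exp (- \<gamma> * y)) / \<gamma>) + ennreal (exp (- \<gamma> * y)) * laplace_on (killed_ruin n) \<gamma>" if y: "0 \<le> y" for y
  proof -
    have "(\<integral>\<^sup>+v. indicator {0..} v * ennreal (exp (- \<gamma> * v)) * killed_ruin n (v - y) \<partial>lborel) =
      (\<integral>\<^sup>+v. indicator {0..y} v * ennreal (exp (- \<gamma> * v)) + 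
         indicator {y..} v * ennreal (exp (- \<gamma> * v)) * killed_ruin n (v - y) \<partial>lborel)"
      using AE_lborel_singleton[of y] y
      by (intro nn_integral_cong_AE) (auto elim!: eventually_mono simp: indicator_def killed_ruin_nonpos)
    also have "\<dots> = (\<integral>\<^sup>+v. indicator {0..y} v * ennreal (exp (- \<gamma> * v)) \<partial>lborel) +
       (\<integral>\<^sup>+v. indicator {y..} v * ennreal (exp (- \<gamma> * v)) * killed_ruin n (v - y) \<partial>lborel)"
      by (rule nn_integral_add) measurable
    also have "(\<integral>\<^sup>+v. indicator {0..y} v * ennreal (exp (- \<gamma> * v)) \<partial>lborel) = ennreal ((1 - exp (- \<gamma> * y)) / \<gamma>)"
      using \<gamma> y by (intro nn_integral_exp_interval) auto
    also have "(\<integral>\<^sup>+v. indicator {y..} v * ennreal (exp (- \<gamma> * v)) * killed_ruin n (v - y) \<partial>lborel) =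
        (\<integral>\<^sup>+v. indicator {y..} (y + v) * ennreal (exp (- \<gamma> * (y + v))) * killed_ruin n v \<partial>lborel)"
      by (subst nn_integral_real_affine[where c=1 and t=y]) auto
    also have "\<dots> = (\<integral>\<^sup>+v. ennreal (exp (- \<gamma> * y)) * (indicator {0..} v * ennreal (exp (- \<gamma> * v)) * killed_ruin n v) \<partial>lborel)"
    proof (rule nn_integral_cong)
      fix v :: real
      have "exp (- \<gamma> * (y + v)) = exp (- \<gamma> * y) * exp (- \<gamma> * v)"
        by (simp add: exp_add[symmetric] algebra_simps)
      then have "ennreal (exp (- \<gamma> * (y + v))) = ennreal (exp (- \<gamma> * y)) * ennreal (exp (- \<gamma> * v))"
        by (simp add: ennreal_mult[symmetric])
      then show "indicator {y..} (y + v) * ennreal (exp (- \<gamma> * (y + v))) * killed_ruin n v =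
         ennreal (exp (- \<gamma> * y)) * (indicator {0..} v * ennreal (exp (- \<gamma> * v)) * killed_ruin n v)"
        by (cases "0 \<le> v") (simp_all add: mult.assoc)
    qed
    also have "\<dots> = ennreal (exp (- \<gamma> * y)) * laplace_on (killed_ruin n) \<gamma>"
      unfolding laplace_on_def by (rule nn_integral_cmult) measurable
    finally show ?thesis .
  qed
  have int: "integrable Q (\<lambda>y. exp (- \<gamma> * y))"
    using Q_nonneg \<gamma> by (intro Q.integrable_const_bound[where B=1]) (auto elim!: eventually_mono)
  let ?l = "LINT y|Q. exp (- \<gamma> * y)"
  have l: "(\<integral>\<^sup>+y. ennreal (exp (- \<gamma> * y)) \<partial>Q) = ennreal ?l"
    using int by (intro nn_integral_eq_integral) auto
  have l1: "(\<integral>\<^sup>+y. ennreal ((1 - exp (- \<gamma> * y)) / \<gamma>) \<partial>Q) = ennreal ((1 - ?l) / \<gamma>)"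
    and l1_nonneg: "0 \<le> (1 - ?l) / \<gamma>"
  proof -
    have nn: "AE y in Q. 0 \<le> (1 - exp (- \<gamma> * y)) / \<gamma>"
      using Q_nonneg \<gamma> by (auto elim!: eventually_mono)
    have i: "integrable Q (\<lambda>y. (1 - exp (- \<gamma> * y)) / \<gamma>)" using int by simp
    have e: "(LINT y|Q. (1 - exp (- \<gamma> * y)) / \<gamma>) = (1 - ?l) / \<gamma>"
      using int Q.prob_space by simp
    show "(\<integral>\<^sup>+y. ennreal ((1 - exp (- \<gamma> * y)) / \<gamma>) \<partial>Q) = ennreal ((1 - ?l) / \<gamma>)"
      using nn_integral_eq_integral[OF i nn] by (simp only: e)
    show "0 \<le> (1 - ?l) / \<gamma>" using integral_nonneg_AE[OF nn] by (simp only: e)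
  qed
  have l_nonneg: "0 \<le> ?l" and \<psi>_nonneg: "0 \<le> \<psi> n \<gamma>" by (simp_all add: \<psi>_def)
  have "laplace_on (claim_ruin n) \<gamma> = (\<integral>\<^sup>+v. \<integral>\<^sup>+y. indicator {0..} v * ennreal (exp (- \<gamma> * v)) * killed_ruin n (v - y) \<partial>Q \<partial>lborel)"
    unfolding laplace_on_def claim_ruin_def by (intro nn_integral_cong nn_integral_cmult[symmetric]) measurable
  also have "\<dots> = (\<integral>\<^sup>+y. \<integral>\<^sup>+v. indicator {0..} v * ennreal (exp (- \<gamma> * v)) * killed_ruin n (v - y) \<partial>lborel \<partial>Q)"
    by (rule lborel_Q.Fubini'[symmetric]) measurable
  also have "\<dots> = (\<integral>\<^sup>+y. ennreal ((1 - exp (- \<gamma> * y)) / \<gamma>) + ennreal (exp (- \<gamma> * y)) * laplace_on (killed_ruin n) \<gamma> \<partial>Q)"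
    using Q_nonneg by (intro nn_integral_cong_AE, eventually_elim) (rule claim)
  also have "\<dots> = ennreal ((1 - ?l) / \<gamma>) + ennreal ?l * laplace_on (killed_ruin n) \<gamma>"
    by (subst nn_integral_add) (measurable, simp only: nn_integral_multc l l1, subst nn_integral_multc, measurable, simp only: l)
  also have "laplace_on (killed_ruin n) \<gamma> = ennreal (\<psi> n \<gamma>)"
    unfolding \<psi>_def using laplace_on_le[OF killed_ruin_le_1[of n] \<gamma>]
    by (intro ennreal_enn2real[symmetric]) (auto simp: order.strict_trans1[of _ "ennreal (1 / \<gamma>)"])
  also have "ennreal ((1 - ?l) / \<gamma>) + ennreal ?l * ennreal (\<psi> n \<gamma>) = ennreal ((1 - ?l) / \<gamma> + ?l * \<psi> n \<gamma>)"
    by (simp only: ennreal_mult[OF l_nonneg \<psi>_nonneg, symmetric] ennreal_plus[OF l1_nonneg mult_nonneg_nonneg[OF l_nonneg \<psi>_nonneg]])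
  finally have "enn2real (laplace_on (claim_ruin n) \<gamma>) = (1 - ?l) / \<gamma> + ?l * \<psi> n \<gamma>"
    by (simp only: enn2real_ennreal[OF add_nonneg_nonneg[OF l1_nonneg mult_nonneg_nonneg[OF l_nonneg \<psi>_nonneg]]])
  also have "\<dots> = 1 / \<gamma> - ?l * (1 / \<gamma> - \<psi> n \<gamma>)" using \<gamma> by (simp add: field_simps)
  finally show ?thesis .
qed

text \<open>
  The constants \<open>1 / \<gamma>\<close> and \<open>1 / \<alpha>\<close> of the two transforms (\<open>\<alpha> = (\<lambda> n + \<theta>) / (r n)\<close>) differ by a multiple of
  \<open>\<lambda> n + \<theta> - \<gamma> r n\<close>, so the denominator cancels in the first summand.
\<close>

lemma \<psi>_recursion:
  assumes \<gamma>: "0 < \<gamma>" "\<gamma> \<noteq> (lam * real n + \<theta>) / (r * real n)" and n: "1 \<le> n"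
  shows "\<psi> n \<gamma> = lam * real n / (lam * real n + \<theta>) * (1 / \<gamma>) +
    lam * real n / (lam * real n + \<theta> - \<gamma> * r * real n) *
      ((LINT y|Q. exp (- ((lam * real n + \<theta>) / (r * real n)) * y)) *
         (1 / ((lam * real n + \<theta>) / (r * real n)) - \<psi> (n - 1) ((lam * real n + \<theta>) / (r * real n)))
       - (LINT y|Q. exp (- \<gamma> * y)) * (1 / \<gamma> - \<psi> (n - 1) \<gamma>))"
proof -
  define a where "a = lam * real n + \<theta>"
  define c where "c = r * real n"
  have c: "0 < c" using r n by (simp add: c_def)
  have a: "0 < a" using lam \<theta> n by (simp add: a_def add_pos_pos)
  have ne: "a - \<gamma> * c \<noteq> 0" using \<gamma>(2) c unfolding a_def[symmetric] c_def[symmetric] by (simp add: field_simps)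
  have "1 / \<gamma> - 1 / (a / c) = (a - \<gamma> * c) / (a * \<gamma>)"
    using \<gamma> a c by (simp add: field_simps)
  then have *: "b / (a - \<gamma> * c) * (1 / \<gamma> - 1 / (a / c)) = b / a * (1 / \<gamma>)" for b
    using ne by simp
  have "k * ((p - X) - (q - Y)) = k * (p - q) + k * (Y - X)" for k p q X Y :: real
    by (simp add: algebra_simps)
  then have "b / (a - \<gamma> * c) * ((1 / \<gamma> - X) - (1 / (a / c) - Y)) = b / a * (1 / \<gamma>) + b / (a - \<gamma> * c) * (Y - X)" for b X Y
    unfolding *[symmetric] .
  moreover have "0 < a / c" using a c by simp
  ultimately show ?thesis
    using laplace_killed_ruin[OF assms] laplace_claim_ruin[OF \<gamma>(1)] laplace_claim_ruin[of "a / c"]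
    unfolding mult.assoc[of \<gamma> r] a_def[symmetric] c_def[symmetric] by (simp only:)
qed

end

section \<open>From the obligor pool to the product space\<close>

lemma net_loss_eq_pool_loss:
  "net_loss r n T Ls s \<omega> =
    pool_loss r {1..n} (\<lambda>i\<in>{1..n}. T i \<omega>) (\<lambda>i\<in>{1..n}. Ls i \<omega>) s"
  unfolding net_loss_def pool_loss_def by (intro sum.cong) auto

context risk_model begin

text \<open>
  Independence within and between the two families says exactly that the pair of vectors has a product law.
  The characterisation of independence by a product law concerns nonempty families, hence \<open>1 \<le> n\<close>; without obligors ruin is
  deterministic.
\<close>

lemma pool_law:
  assumes "obligor_pool M n T Ls lam Q" and n: "1 \<le> n"
  shows "distr M (PiM {1..n} (\<lambda>_. borel) \<Otimes>\<^sub>M PiM {1..n} (\<lambda>_. borel))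
      (\<lambda>\<omega>. (\<lambda>i\<in>{1..n}. T i \<omega>, \<lambda>i\<in>{1..n}. Ls i \<omega>)) = default_times_law {1..n} \<Otimes>\<^sub>M losses_law {1..n}"
    and "(\<lambda>\<omega>. (\<lambda>i\<in>{1..n}. T i \<omega>, \<lambda>i\<in>{1..n}. Ls i \<omega>))
      \<in> measurable M (PiM {1..n} (\<lambda>_. borel) \<Otimes>\<^sub>M PiM {1..n} (\<lambda>_. borel))"
proof -
  interpret obligor_pool M n T Ls lam Q by fact
  have T: "T i \<in> borel_measurable M" "distr M borel (T i) = default_law" if "i \<in> {1..n}" for i
  proof -
    note D = default_time_distributed[OF that]
    from distributed_measurable[OF D] show "T i \<in> borel_measurable M" by simp
    have "distr M borel (T i) = distr M lborel (T i)" by (rule distr_cong) auto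
    then show "distr M borel (T i) = default_law" using distributed_distr_eq_density[OF D] by simp
  qed
  have L: "Ls i \<in> borel_measurable M" if "i \<in> {1..n}" for i
    using losses_indep that by (auto simp: indep_vars_def)
  have ne: "{1..n} \<noteq> {}" using n by auto
  have dT: "distr M (PiM {1..n} (\<lambda>_. borel)) (\<lambda>\<omega>. \<lambda>i\<in>{1..n}. T i \<omega>) = default_times_law {1..n}"
    using indep_vars_iff_distr_eq_PiM'[of "{1..n}" T "\<lambda>_. borel"] ne T default_times_indep
    by (auto intro!: PiM_cong)
  have dL: "distr M (PiM {1..n} (\<lambda>_. borel)) (\<lambda>\<omega>. \<lambda>i\<in>{1..n}. Ls i \<omega>) = losses_law {1..n}"
    using indep_vars_iff_distr_eq_PiM'[of "{1..n}" Ls "\<lambda>_. borel"] ne L losses_indep loss_distr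
    by (auto intro!: PiM_cong)
  note ind = default_times_losses_indep[unfolded indep_var_distribution_eq]
  show "distr M (PiM {1..n} (\<lambda>_. borel) \<Otimes>\<^sub>M PiM {1..n} (\<lambda>_. borel))
      (\<lambda>\<omega>. (\<lambda>i\<in>{1..n}. T i \<omega>, \<lambda>i\<in>{1..n}. Ls i \<omega>)) = default_times_law {1..n} \<Otimes>\<^sub>M losses_law {1..n}"
    using ind dT dL by simp
  show "(\<lambda>\<omega>. (\<lambda>i\<in>{1..n}. T i \<omega>, \<lambda>i\<in>{1..n}. Ls i \<omega>))
      \<in> measurable M (PiM {1..n} (\<lambda>_. borel) \<Otimes>\<^sub>M PiM {1..n} (\<lambda>_. borel))"
    using ind by (intro measurable_Pair) auto
qed

lemma ruin_prob_eq_pool_ruin: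
  assumes pool: "obligor_pool M n T Ls lam Q"
  shows "ruin_prob r M n T Ls u t = enn2real (pool_ruin {1..n} u t)"
proof (cases "n = 0")
  case True
  interpret obligor_pool M n T Ls lam Q by fact
  have "net_loss r n T Ls s \<omega> = 0" for s \<omega> using True by (simp add: net_loss_def)
  then have "ruin_prob r M n T Ls u t = measure M {\<omega> \<in> space M. 0 \<le> t \<and> u \<le> 0}"
    unfolding ruin_prob_def by (intro arg_cong[where f="measure M"]) auto
  then show ?thesis using True prob_space by (auto simp: pool_ruin_empty)
next
  case False
  interpret obligor_pool M n T Ls lam Q by fact
  let ?I = "{1..n}"
  let ?B = "PiM ?I (\<lambda>_. borel :: real measure)"
  define X where "X \<omega> = (\<lambda>i\<in>?I. T i \<omega>, \<lambda>i\<in>?I. Ls i \<omega>)" for \<omega>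
  define g where "g z = (if ruined r ?I (fst z) (snd z) u t then 1 else 0 :: ennreal)"
    for z :: "(nat \<Rightarrow> real) \<times> (nat \<Rightarrow> real)"
  have law: "distr M (?B \<Otimes>\<^sub>M ?B) X = default_times_law ?I \<Otimes>\<^sub>M losses_law ?I" and X: "X \<in> measurable M (?B \<Otimes>\<^sub>M ?B)"
    using pool_law[OF pool] False unfolding X_def by auto
  have g: "g \<in> borel_measurable (default_times_law ?I \<Otimes>\<^sub>M losses_law ?I)"
    unfolding g_def by (rule borel_measurable_ruined) measurable
  then have g': "g \<in> borel_measurable (distr M (?B \<Otimes>\<^sub>M ?B) X)" by (simp only: law)
  then have gB: "g \<in> borel_measurable (?B \<Otimes>\<^sub>M ?B)" by simp
  have "pool_ruin ?I u t = (\<integral>\<^sup>+z. g z \<partial>(default_times_law ?I \<Otimes>\<^sub>M losses_law ?I))"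
    unfolding pool_ruin_def losses.nn_integral_fst[OF g, symmetric] by (simp only: g_def fst_conv snd_conv)
  also have "\<dots> = (\<integral>\<^sup>+\<omega>. g (X \<omega>) \<partial>M)"
    unfolding law[symmetric] by (rule nn_integral_distr[OF X g'])
  also have "\<dots> = (\<integral>\<^sup>+\<omega>. indicator {\<omega> \<in> space M. g (X \<omega>) = 1} \<omega> \<partial>M)"
    by (intro nn_integral_cong) (auto simp: g_def indicator_def)
  also have "\<dots> = emeasure M {\<omega> \<in> space M. g (X \<omega>) = 1}"
  proof (rule nn_integral_indicator)
    have "(\<lambda>\<omega>. g (X \<omega>)) \<in> borel_measurable M" using X gB by (rule measurable_compose)
    then show "{\<omega> \<in> space M. g (X \<omega>) = 1} \<in> events" by measurable
  qed
  also have "{\<omega> \<in> space M. g (X \<omega>) = 1} = {\<omega> \<in> space M. \<exists>s\<in>{0..t}. net_loss r n T Ls s \<omega> \<ge> u}"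
    by (auto simp: g_def X_def ruined_def net_loss_eq_pool_loss)
  finally show ?thesis by (simp add: ruin_prob_def measure_def)
qed

lemma ruin_prob_killed_eq_killed_ruin:
  assumes pool: "obligor_pool M n T Ls lam Q"
  shows "ruin_prob_killed r \<theta> M n T Ls u = enn2real (killed_ruin n u)"
proof -
  have [measurable]: "(\<lambda>t. pool_ruin {1..n} u t) \<in> borel_measurable borel" by (rule borel_measurable_pool_ruin) auto
  have finite_prob: "ennreal (enn2real (pool_ruin {1..n} u t)) = pool_ruin {1..n} u t" for t
    using pool_ruin_le_1[of "{1..n}" u t] by (intro ennreal_enn2real) (auto simp: order.strict_trans1[of _ 1])
  have "ruin_prob_killed r \<theta> M n T Ls u =
      (LINT t|lborel. indicator {0..} t * (\<theta> * exp (- \<theta> * t) * enn2real (pool_ruin {1..n} u t)))"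
    by (simp add: ruin_prob_killed_def set_lebesgue_integral_def ruin_prob_eq_pool_ruin[OF pool])
  also have "\<dots> = enn2real (\<integral>\<^sup>+t. ennreal (indicator {0..} t * (\<theta> * exp (- \<theta> * t) * enn2real (pool_ruin {1..n} u t))) \<partial>lborel)"
    using \<theta> by (intro integral_eq_nn_integral) auto
  also have "(\<integral>\<^sup>+t. ennreal (indicator {0..} t * (\<theta> * exp (- \<theta> * t) * enn2real (pool_ruin {1..n} u t))) \<partial>lborel) = killed_ruin n u"
    unfolding killed_ruin_def using \<theta> by (intro nn_integral_cong) (auto simp: indicator_def ennreal_mult finite_prob[simplified])
  finally show ?thesis .
qed

lemma ruin_transform_eq_\<psi>:
  assumes pool: "obligor_pool M n T Ls lam Q" and \<gamma>: "0 < \<gamma>"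
  shows "ruin_transform r \<theta> M n T Ls \<gamma> = \<psi> n \<gamma>"
proof -
  have "ruin_transform r \<theta> M n T Ls \<gamma> = (LINT u|lborel. indicator {0..} u * exp (- \<gamma> * u) * enn2real (killed_ruin n u))"
    by (simp add: ruin_transform_def set_lebesgue_integral_def ruin_prob_killed_eq_killed_ruin[OF pool] mult.assoc)
  also have "\<dots> = \<psi> n \<gamma>"
    unfolding \<psi>_def using laplace_on_has_integral[OF borel_measurable_killed_ruin killed_ruin_le_1 \<gamma>]
    by (rule has_bochner_integral_integral_eq)
  finally show ?thesis .
qed

lemma \<psi>_0: "\<psi> 0 \<gamma> = 0"
proof -
  have "killed_ruin 0 u = 0" if "0 < u" for u using that by (simp add: killed_ruin_def pool_ruin_empty)
  then have "laplace_on (killed_ruin 0) \<gamma> = (\<integral>\<^sup>+(u::real). 0 \<partial>lborel)"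
    unfolding laplace_on_def using AE_lborel_singleton[of 0]
    by (intro nn_integral_cong_AE) (auto elim!: eventually_mono simp: indicator_def)
  then show ?thesis by (simp add: \<psi>_def)
qed

end

theorem theorem2p1:
  fixes lam r \<theta> :: real
    and N :: "'b measure" and L :: "'b \<Rightarrow> real"
    and M :: "nat \<Rightarrow> 'a measure" and T Ls :: "nat \<Rightarrow> nat \<Rightarrow> 'a \<Rightarrow> real"
  assumes "lam > 0" and "r > 0" and "\<theta> > 0"
    and "prob_space N" and "L \<in> borel_measurable N" and "AE \<omega> in N. L \<omega> \<ge> 0"
    and "\<And>n. obligor_pool (M n) n (T n) (Ls n) lam (distr N borel L)"
  shows "let \<psi> = (\<lambda>n. ruin_transform r \<theta> (M n) n (T n) (Ls n));
             lap = laplace_transform N L;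
             B = (\<lambda>x y. lap x * (1 / x - y))
         in (\<forall>\<gamma>>0. \<psi> 0 \<gamma> = 0) \<and>
            (\<forall>n\<ge>1. \<forall>\<gamma>>0. \<gamma> \<noteq> (lam * real n + \<theta>) / (r * real n) \<longrightarrow>
               \<psi> n \<gamma> =
                 lam * real n / (lam * real n + \<theta>) * (1 / \<gamma>) +
                 lam * real n / (lam * real n + \<theta> - \<gamma> * r * real n) *
                   (B ((lam * real n + \<theta>) / (r * real n))
                      (\<psi> (n - 1) ((lam * real n + \<theta>) / (r * real n)))
                    - B \<gamma> (\<psi> (n - 1) \<gamma>)))"
proof -
  let ?Q = "distr N borel L"
  interpret risk_model lam r \<theta> ?Q
  proof (rule risk_model.intro)
    show "prob_space ?Q" by (rule prob_space.prob_space_distr) fact+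
    show "AE y in ?Q. 0 \<le> y" using assms(5,6) by (subst AE_distr_iff) auto
  qed (use assms(1-3) in simp_all)
  have trans: "ruin_transform r \<theta> (M n) n (T n) (Ls n) \<gamma> = \<psi> n \<gamma>" if "0 < \<gamma>" for n \<gamma>
    by (rule ruin_transform_eq_\<psi>[OF assms(7) that])
  have lap: "(LINT y|?Q. exp (- \<gamma> * y)) = laplace_transform N L \<gamma>" for \<gamma>
    unfolding laplace_transform_def by (rule integral_distr[OF assms(5)]) measurable
  have pos: "0 < (lam * real n + \<theta>) / (r * real n)" if "1 \<le> n" for n
    using assms(1-3) that by (intro divide_pos_pos) (auto intro: add_pos_pos)
  show ?thesis
    unfolding Let_def
  proof (intro conjI allI impI)
    fix \<gamma> :: real assume "0 < \<gamma>"
    then show "ruin_transform r \<theta> (M 0) 0 (T 0) (Ls 0) \<gamma> = 0" by (simp only: trans \<psi>_0)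
  next
    fix n :: nat and \<gamma> :: real
    assume n: "1 \<le> n" and \<gamma>: "0 < \<gamma>" and ne: "\<gamma> \<noteq> (lam * real n + \<theta>) / (r * real n)"
    show "ruin_transform r \<theta> (M n) n (T n) (Ls n) \<gamma> =
      lam * real n / (lam * real n + \<theta>) * (1 / \<gamma>) +
      lam * real n / (lam * real n + \<theta> - \<gamma> * r * real n) *
        (laplace_transform N L ((lam * real n + \<theta>) / (r * real n)) *
          (1 / ((lam * real n + \<theta>) / (r * real n)) -
           ruin_transform r \<theta> (M (n - 1)) (n - 1) (T (n - 1)) (Ls (n - 1)) ((lam * real n + \<theta>) / (r * real n)))
         - laplace_transform N L \<gamma> *
          (1 / \<gamma> - ruin_transform r \<theta> (M (n - 1)) (n - 1) (T (n - 1)) (Ls (n - 1)) \<gamma>))"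
      using \<psi>_recursion[OF \<gamma> ne n] unfolding trans[OF \<gamma>] trans[OF pos[OF n]] lap .
  qed
qed

end
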